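(* Let $T : (\Omega_1,d_1,\mu_1)\to(\Omega_2,d_2,\mu_2)$ denote a contraction between two metric-measure spaces pushing forward $\mu_1$ onto $\mu_2$ up to a finite constant $c\in(0,\infty)$. Then \[ \lambda^{\mathrm{Lip}}_k(\Omega_2,d_2,\mu_2)\geq\lambda^{\mathrm{Lip}}_k(\Omega_1,d_1,\mu_1)\quad\forall k\geq 1. \]
   Context: A metric-measure space $(\Omega,d,\mu)$ is a separable metric space $(\Omega,d)$ with a locally-finite Borel measure $\mu$. A Borel map $T$ is a contraction if $d_2(T(x),T(y))\leq d_1(x,y)$ for all $x,y\in\Omega_1$; it pushes forward $\mu_1$ onto $\mu_2$ up to the finite constant $c$ if $\mu_1\circ T^{-1} = c\,\mu_2$. Neither injectivity of $T$ nor full support of $\mu_i$ is assumed. Let $\mathcal{F}(\Omega,d)$ be the class of locally Lipschitz functions on $\Omega$ (Lipschitz on some open neighborhood of each point). For $f\in\mathcal{F}(\Omega,d)$ the local Lipschitz constant is the Borel function \[ |\nabla f|(x) := \limsup_{y\to x}\frac{|f(y)-f(x)|}{d(y,x)} \] (defined as $0$ if $x$ is an isolated point). For a Borel measurable $f$ on $\Omega$ set \[ \|f\|^2_{\dot W^{1,2}_{Lip}(\mu)} := \inf\left\{\int|\nabla g|^2\,d\mu : g\in\mathcal{F}(\Omega,d),\ g=f\ \mu\text{-a.e.}\right\}. \] The metric Sobolev space $W^{1,2}_{Lip}(\mu)=W^{1,2}_{Lip}(\Omega,d,\mu)$ is the linear subspace of $L^2(\mu)$ consisting of elements $f$ with $\|f\|_{\dot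 W^{1,2}_{Lip}(\mu)}<\infty$, equipped with the scalar product inherited from $L^2(\mu)$. The $k$-th metric eigenvalue is defined as \[ \lambda^{\mathrm{Lip}}_k(\Omega,d,\mu) := \sup_{E\subset W^{1,2}_{Lip}(\mu),\ \dim E=k-1}\ \inf_{f\in W^{1,2}_{Lip}(\mu)\cap E^\perp,\ f\neq 0}\ \frac{\|f\|^2_{\dot W^{1,2}_{Lip}(\mu)}}{\|f\|^2_{L^2(\mu)}} = \inf_{F\subset W^{1,2}_{Lip}(\mu),\ \dim F=k}\ \sup_{f\in F,\ f\neq 0}\ \frac{\|f\|^2_{\dot W^{1,2}_{Lip}(\mu)}}{\|f\|^2_{L^2(\mu)}}, \] where $E,F,E^\perp$ range over linear subspaces of $W^{1,2}_{Lip}(\mu)$, $E^\perp$ is the orthogonal complement with respect to the $L^2(\mu)$ scalar product, and $0$ is the zero element of $W^{1,2}_{Lip}(\mu)$. The first (sup-inf) expression is the definition; its equality with the second (inf-sup) expression is asserted in the paper as following from elementary linear algebra. *)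

theory Defs
  imports "HOL-Analysis.Analysis"
begin

definition metric_measure_space :: "'a::metric_space measure \<Rightarrow> bool" where
  "metric_measure_space \<mu> \<longleftrightarrow>
     separable_space (euclidean :: 'a topology) \<and>
     sets \<mu> = sets borel \<and>
     (\<forall>x. \<exists>U. open U \<and> x \<in> U \<and> emeasure \<mu> U < \<infinity>)"

definition locally_lipschitz :: "('a::metric_space \<Rightarrow> real) \<Rightarrow> bool" where
  "locally_lipschitz f \<longleftrightarrow> (\<forall>x. \<exists>U L. open U \<and> x \<in> U \<and> L-lipschitz_on U f)"

text \<open>The limit superior is taken in \<^typ>\<open>ennreal\<close>, where the limit superior along the trivial
  filter is 0; this gives the value 0 at isolated points.\<close>

definition local_lip_const :: "('a::metric_space \<Rightarrow> real) \<Rightarrow> 'a \<Rightarrow> ennreal" where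
  "local_lip_const f x = Limsup (at x) (\<lambda>y. ennreal (\<bar>f y - f x\<bar> / dist y x))"

lemma local_lip_const_isolated: "open {x} \<Longrightarrow> local_lip_const f x = 0"
proof -
  assume "open {x}"
  then have "at x = bot"
    by (auto simp: trivial_limit_def eventually_at_topological)
  then show ?thesis
    by (simp add: local_lip_const_def bot_ennreal)
qed

text \<open>The squared homogeneous Sobolev seminorm; it is \<^term>\<open>\<infinity>\<close> if no competitor exists.\<close>

definition sobolev_energy :: "'a::metric_space measure \<Rightarrow> ('a \<Rightarrow> real) \<Rightarrow> ennreal" where
  "sobolev_energy \<mu> f =
     (INF g \<in> {g. locally_lipschitz g \<and> (AE x in \<mu>. g x = f x)}. \<integral>\<^sup>+ x. (local_lip_const g x)\<^sup>2 \<partial>\<mu>)"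

text \<open>Elements of \<open>L\<^sup>2(\<mu>)\<close> are represented by square integrable Borel functions, and two functions
  represent the same element iff they agree almost everywhere. The linear subspaces of \<open>L\<^sup>2(\<mu>)\<close>
  then correspond exactly to the sets of functions satisfying \<open>L2_subspace\<close> below, where closure
  under almost everywhere equality is part of the definition. The predicate \<open>L2_dim \<mu> E n\<close> says that
  the space of almost everywhere classes of \<open>E\<close> has a basis with \<open>n\<close> elements.\<close>

definition L2_functions :: "'a measure \<Rightarrow> ('a \<Rightarrow> real) set" where
  "L2_functions \<mu> = {f \<in> borel_measurable \<mu>. integrable \<mu> (\<lambda>x. (f x)\<^sup>2)}"

definition L2_subspace :: "'a measure \<Rightarrow> ('a \<Rightarrow> real) set \<Rightarrow> bool" where
  "L2_subspace \<mu> E \<longleftrightarrow>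
     E \<subseteq> L2_functions \<mu> \<and>
     (\<lambda>x. 0) \<in> E \<and>
     (\<forall>f\<in>E. \<forall>g\<in>E. (\<lambda>x. f x + g x) \<in> E) \<and>
     (\<forall>a. \<forall>f\<in>E. (\<lambda>x. a * f x) \<in> E) \<and>
     (\<forall>f\<in>E. \<forall>g\<in>borel_measurable \<mu>. (AE x in \<mu>. g x = f x) \<longrightarrow> g \<in> E)"

definition L2_dim :: "'a measure \<Rightarrow> ('a \<Rightarrow> real) set \<Rightarrow> nat \<Rightarrow> bool" where
  "L2_dim \<mu> E n \<longleftrightarrow>
     (\<exists>b :: nat \<Rightarrow> 'a \<Rightarrow> real.
        (\<forall>i<n. b i \<in> E) \<and>
        (\<forall>a :: nat \<Rightarrow> real. (AE x in \<mu>. (\<Sum>i<n. a i * b i x) = 0) \<longrightarrow> (\<forall>i<n. a i = 0)) \<and>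
        (\<forall>f\<in>E. \<exists>a :: nat \<Rightarrow> real. AE x in \<mu>. f x = (\<Sum>i<n. a i * b i x)))"

definition sobolev_space :: "'a::metric_space measure \<Rightarrow> ('a \<Rightarrow> real) set" where
  "sobolev_space \<mu> = {f \<in> L2_functions \<mu>. sobolev_energy \<mu> f < \<infinity>}"

definition rayleigh_quotient :: "'a::metric_space measure \<Rightarrow> ('a \<Rightarrow> real) \<Rightarrow> ennreal" where
  "rayleigh_quotient \<mu> f = sobolev_energy \<mu> f / ennreal (\<integral>x. (f x)\<^sup>2 \<partial>\<mu>)"

definition sobolev_orthogonal_complement ::
    "'a::metric_space measure \<Rightarrow> ('a \<Rightarrow> real) set \<Rightarrow> ('a \<Rightarrow> real) set" where
  "sobolev_orthogonal_complement \<mu> E =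
     {f \<in> sobolev_space \<mu>. \<forall>e\<in>E. (\<integral>x. f x * e x \<partial>\<mu>) = 0}"

definition sobolev_subspaces :: "'a::metric_space measure \<Rightarrow> nat \<Rightarrow> ('a \<Rightarrow> real) set set" where
  "sobolev_subspaces \<mu> n = {E. E \<subseteq> sobolev_space \<mu> \<and> L2_subspace \<mu> E \<and> L2_dim \<mu> E n}"

text \<open>The \<open>k\<close>-th metric eigenvalue for \<open>k \<ge> 1\<close>. An infimum over the empty set is \<^term>\<open>\<infinity>\<close>. If
  the Sobolev space has dimension less than \<open>k - 1\<close>, the supremum ranges over no subspace at all;
  the eigenvalue is then \<^term>\<open>\<infinity>\<close>, as it is in dimension \<open>k - 1\<close> (and as given by the inf-sup
  formula over \<open>k\<close>-dimensional subspaces), and not the default value 0 of an empty supremum.\<close>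

definition lip_eigenvalue :: "'a::metric_space measure \<Rightarrow> nat \<Rightarrow> ennreal" where
  "lip_eigenvalue \<mu> k =
     (if sobolev_subspaces \<mu> (k - 1) = {} then \<infinity>
      else SUP E \<in> sobolev_subspaces \<mu> (k - 1).
             INF f \<in> {f \<in> sobolev_orthogonal_complement \<mu> E. \<not> (AE x in \<mu>. f x = 0)}.
               rayleigh_quotient \<mu> f)"

end

theory Submission
  imports Defs
begin

text \<open>Pulling back along \<open>T\<close> maps \<open>W\<^sub>2 = W(\<mu>\<^sub>2)\<close> injectively into \<open>W(\<mu>\<^sub>1)\<close>, multiplies squared
  \<open>L\<^sup>2\<close> norms by \<open>c\<close> and energies by at most \<open>c\<close>, so it does not increase Rayleigh quotients. For
  the sup-inf definition let \<open>E \<subseteq> W(\<mu>\<^sub>1)\<close> be spanned by \<open>b\<^sub>1, \<dots>, b\<^sub>m\<close> with \<open>m = k - 1\<close>. If the functionals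
  \<open>l\<^sub>i f = \<integral> f(T x) b\<^sub>i(x) d\<mu>\<^sub>1\<close> on \<open>W\<^sub>2\<close> vanish at \<open>f\<close>, then the pullback of \<open>f\<close> is orthogonal to \<open>E\<close>. The
  \<open>l\<^sub>i\<close> need not be represented by elements of \<open>W\<^sub>2\<close>, but they are up to an arbitrarily small error
  in operator norm. If \<open>f\<close> is orthogonal to the approximate representers, then all \<open>l\<^sub>i f\<close> are small,
  and a small combination of fixed elements of \<open>W\<^sub>2\<close> moves \<open>f\<close> into the joint kernel of the \<open>l\<^sub>i\<close>. Since
  the energy is the square of a seminorm, this changes the Rayleigh quotient only slightly. The argument
  does not use the inf-sup formula, and the energy may fail to be a quadratic form.\<close>

section \<open>Local Lipschitz constants\<close>

text \<open>This lets bounds on the \<open>ennreal\<close> limsup be proved by real inequalities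
  near \<open>x\<close>. The strict margin \<open>r > C\<close> is the slack of a limsup, and
  multiplying by \<open>dist y x\<close> removes the division.\<close>

lemma local_lip_const_le_iff:
  assumes "0 \<le> C"
  shows "local_lip_const f x \<le> ennreal C \<longleftrightarrow>
    (\<forall>r>C. \<forall>\<^sub>F y in at x. \<bar>f y - f x\<bar> \<le> r * dist y x)"
proof
  assume L: "local_lip_const f x \<le> ennreal C"
  show "\<forall>r>C. \<forall>\<^sub>F y in at x. \<bar>f y - f x\<bar> \<le> r * dist y x"
  proof (intro allI impI)
    fix r assume "C < r"
    then have "ennreal C < ennreal r"
      using assms by (simp add: ennreal_lessI)
    then have "\<forall>\<^sub>F y in at x. ennreal (\<bar>f y - f x\<bar> / dist y x) < ennreal r"
      using L unfolding local_lip_const_def Limsup_le_iff by blast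
    moreover have "\<forall>\<^sub>F y in at x. y \<noteq> x"
      by (simp add: eventually_at_filter)
    ultimately show "\<forall>\<^sub>F y in at x. \<bar>f y - f x\<bar> \<le> r * dist y x"
    proof eventually_elim
      case (elim y)
      then have "\<bar>f y - f x\<bar> / dist y x < r"
        using \<open>C < r\<close> assms by (subst (asm) ennreal_less_iff) auto
      then show ?case
        using elim by (simp add: field_simps)
    qed
  qed
next
  assume R: "\<forall>r>C. \<forall>\<^sub>F y in at x. \<bar>f y - f x\<bar> \<le> r * dist y x"
  show "local_lip_const f x \<le> ennreal C"
  proof (rule ennreal_le_epsilon)
    fix e :: real assume "0 < e"
    then have "\<forall>\<^sub>F y in at x. \<bar>f y - f x\<bar> \<le> (C + e) * dist y x"
      using R by auto
    moreover have "\<forall>\<^sub>F y in at x. y \<noteq> x"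
      by (simp add: eventually_at_filter)
    ultimately have "\<forall>\<^sub>F y in at x. ennreal (\<bar>f y - f x\<bar> / dist y x) \<le> ennreal (C + e)"
      by eventually_elim (auto intro!: ennreal_leI simp: field_simps)
    then show "local_lip_const f x \<le> ennreal C + ennreal e"
      unfolding local_lip_const_def using assms \<open>0 < e\<close>
      by (subst ennreal_plus[symmetric]) (auto intro: Limsup_bounded)
  qed
qed

lemma local_lip_const_zero [simp]: "local_lip_const (\<lambda>x. 0) x = 0"
  using local_lip_const_le_iff[of 0 "\<lambda>x. 0" x] by simp

lemma local_lip_const_add:
  "local_lip_const (\<lambda>x. f x + g x) x \<le> local_lip_const f x + local_lip_const g x"
proof (cases "local_lip_const f x = \<infinity> \<or> local_lip_const g x = \<infinity>")
  case False
  then obtain a b where ab: "0 \<le> a" "local_lip_const f x = ennreal a"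
      "0 \<le> b" "local_lip_const g x = ennreal b"
    by (metis ennreal_cases infinity_ennreal_def)
  have "local_lip_const (\<lambda>x. f x + g x) x \<le> ennreal (a + b)"
    unfolding local_lip_const_le_iff[OF add_nonneg_nonneg[OF ab(1,3)]]
  proof (intro allI impI)
    fix r assume r: "a + b < r"
    \<comment> \<open>The excess of \<open>r\<close> over \<open>a + b\<close> is shared equally
      between the two summands.\<close>
    define s where "s = (r - a - b) / 2"
    have "a < a + s" "b < b + s" "r = (a + s) + (b + s)"
      using r by (auto simp: s_def field_simps)
    then have "\<forall>\<^sub>F y in at x. \<bar>f y - f x\<bar> \<le> (a + s) * dist y x"
      "\<forall>\<^sub>F y in at x. \<bar>g y - g x\<bar> \<le> (b + s) * dist y x"
      using ab local_lip_const_le_iff[of a f x] local_lip_const_le_iff[of b g x] by auto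
    then show "\<forall>\<^sub>F y in at x. \<bar>f y + g y - (f x + g x)\<bar> \<le> r * dist y x"
    proof eventually_elim
      case (elim y)
      moreover have "r * dist y x = (a + s) * dist y x + (b + s) * dist y x"
        using \<open>r = _\<close> by (simp add: algebra_simps)
      ultimately show ?case by linarith
    qed
  qed
  then show ?thesis
    using ab by (simp add: ennreal_plus)
qed auto

lemma local_lip_const_cmult:
  "local_lip_const (\<lambda>x. a * f x) x \<le> ennreal \<bar>a\<bar> * local_lip_const f x"
proof (cases "a = 0 \<or> local_lip_const f x = \<infinity>")
  case True
  then show ?thesis
    by (cases "a = 0") (auto simp: ennreal_mult_eq_top_iff ennreal_mult_top)
next
  case False
  then obtain b where b: "0 \<le> b" "local_lip_const f x = ennreal b"
    by (metis ennreal_cases infinity_ennreal_def)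
  have "local_lip_const (\<lambda>x. a * f x) x \<le> ennreal (\<bar>a\<bar> * b)"
    unfolding local_lip_const_le_iff[OF mult_nonneg_nonneg[OF abs_ge_zero b(1)]]
  proof (intro allI impI)
    fix r assume "\<bar>a\<bar> * b < r"
    then have "b < r / \<bar>a\<bar>"
      using False by (simp add: field_simps)
    then have "\<forall>\<^sub>F y in at x. \<bar>f y - f x\<bar> \<le> r / \<bar>a\<bar> * dist y x"
      using b local_lip_const_le_iff[of b f x] by auto
    then show "\<forall>\<^sub>F y in at x. \<bar>a * f y - a * f x\<bar> \<le> r * dist y x"
    proof eventually_elim
      case (elim y)
      have "\<bar>a * f y - a * f x\<bar> = \<bar>a\<bar> * \<bar>f y - f x\<bar>"
        by (simp add: abs_mult[symmetric] algebra_simps)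
      with elim show ?case
        using False by (simp add: field_simps)
    qed
  qed
  then show ?thesis
    using b by (simp add: ennreal_mult)
qed

lemma local_lip_const_contraction:
  assumes T: "\<And>x y. dist (T x) (T y) \<le> dist x y"
  shows "local_lip_const (\<lambda>x. g (T x)) x \<le> local_lip_const g (T x)"
proof (cases "local_lip_const g (T x) = \<infinity>")
  case False
  then obtain b where b: "0 \<le> b" "local_lip_const g (T x) = ennreal b"
    by (metis ennreal_cases infinity_ennreal_def)
  have "local_lip_const (\<lambda>x. g (T x)) x \<le> ennreal b"
    unfolding local_lip_const_le_iff[OF b(1)]
  proof (intro allI impI)
    fix r assume r: "b < r"
    then have "\<forall>\<^sub>F y in at (T x). \<bar>g y - g (T x)\<bar> \<le> r * dist y (T x)"
      using b local_lip_const_le_iff[of b g "T x"] by auto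
    then obtain d where d: "0 < d"
      "\<And>y. y \<noteq> T x \<Longrightarrow> dist y (T x) < d \<Longrightarrow> \<bar>g y - g (T x)\<bar> \<le> r * dist y (T x)"
      unfolding eventually_at by blast
    \<comment> \<open>If \<open>T\<close> identifies \<open>y\<close> with \<open>x\<close>, the
      punctured neighbourhood of \<open>T x\<close> says nothing about \<open>T y\<close>, but then
      \<open>g (T y) - g (T x)\<close> vanishes.\<close>
    have "\<bar>g (T y) - g (T x)\<bar> \<le> r * dist y x" if "dist y x < d" for y
    proof (cases "T y = T x")
      case False
      then have "\<bar>g (T y) - g (T x)\<bar> \<le> r * dist (T y) (T x)"
        using d T[of y x] that by auto
      also have "\<dots> \<le> r * dist y x"
        using T r b by (intro mult_left_mono) auto
      finally show ?thesis .
    qed (use r b in auto)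
    then show "\<forall>\<^sub>F y in at x. \<bar>g (T y) - g (T x)\<bar> \<le> r * dist y x"
      unfolding eventually_at using d(1) by blast
  qed
  then show ?thesis
    using b by simp
qed auto

text \<open>The limsup is the decreasing limit of suprema over punctured balls. Each such supremum
  is lower semicontinuous, since a fixed \<open>y\<close> witnesses a value above \<open>u\<close>
  for an open set of centres \<open>x\<close>.\<close>

lemma borel_measurable_local_lip_const:
  assumes f: "continuous_on UNIV f"
  shows "local_lip_const f \<in> borel_measurable borel"
proof -
  define S where "S e x = (SUP y\<in>ball x e - {x}. ennreal (\<bar>f y - f x\<bar> / dist y x))" for e x
  have S_mono: "S e x \<le> S e' x" if "e \<le> e'" for e e' x
    unfolding S_def using that by (intro SUP_subset_mono) auto
  have "S e \<in> borel_measurable borel" for e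
  proof (rule borel_measurableI_greater)
    fix u
    define U where "U y = {x \<in> ball y e - {y}. u < ennreal (\<bar>f y - f x\<bar> / dist y x)}" for y
    have "open (U y)" for y
    proof -
      have "continuous_on (ball y e - {y}) (\<lambda>x. ennreal (\<bar>f y - f x\<bar> / dist y x))"
        using continuous_on_subset[OF f]
        by (intro continuous_on_ennreal continuous_intros) auto
      then have "open ((\<lambda>x. ennreal (\<bar>f y - f x\<bar> / dist y x)) -` {u<..} \<inter> (ball y e - {y}))"
        by (subst (asm) continuous_on_open_vimage) auto
      also have "(\<lambda>x. ennreal (\<bar>f y - f x\<bar> / dist y x)) -` {u<..} \<inter> (ball y e - {y}) = U y"
        by (auto simp: U_def)
      finally show ?thesis .
    qed
    moreover have "{x \<in> space borel. u < S e x} = (\<Union>y. U y)"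
      unfolding S_def U_def less_SUP_iff by (auto simp: dist_commute)
    ultimately show "{x \<in> space borel. u < S e x} \<in> sets borel"
      by (simp add: borel_open open_UN)
  qed
  moreover have "local_lip_const f = (\<lambda>x. INF n. S (1 / real (Suc n)) x)"
  proof
    fix x
    have "local_lip_const f x = (INF e\<in>{0<..}. S e x)"
      by (simp add: local_lip_const_def Limsup_at S_def)
    also have "\<dots> = (INF n. S (1 / real (Suc n)) x)"
    proof (rule antisym)
      show "(INF n. S (1 / real (Suc n)) x) \<le> (INF e\<in>{0<..}. S e x)"
      proof (rule INF_greatest)
        fix e :: real assume "e \<in> {0<..}"
        then obtain n where "1 / real (Suc n) < e"
          using nat_approx_posE by auto
        then show "(INF n. S (1 / real (Suc n)) x) \<le> S e x"
          by (intro INF_lower2[of n] S_mono) auto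
      qed
    qed (auto intro!: INF_greatest INF_lower)
    finally show "local_lip_const f x = (INF n. S (1 / real (Suc n)) x)" .
  qed
  ultimately show ?thesis
    by simp
qed

section \<open>The Sobolev energy\<close>

text \<open>Young's inequality \<open>2 * x * y \<le> d * x\<^sup>2 + y\<^sup>2 / d\<close>, from
  the square of \<open>d * x - y\<close>. For small \<open>d\<close> the first term is almost
  undisturbed, which is how small corrections are absorbed later.\<close>

lemma power2_add_le_weighted:
  fixes x y d :: real
  assumes "0 < d"
  shows "(x + y)\<^sup>2 \<le> (1 + d) * x\<^sup>2 + (1 + 1 / d) * y\<^sup>2"
proof -
  have "0 \<le> (d * x - y)\<^sup>2 / d"
    using assms by simp
  also have "\<dots> = d * x\<^sup>2 + y\<^sup>2 / d - 2 * x * y"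
    using assms by (simp add: power2_eq_square field_simps)
  finally show ?thesis
    by (simp add: power2_eq_square algebra_simps)
qed

lemma power2_add_le_weighted_ennreal:
  fixes x y :: ennreal
  assumes "0 < d"
  shows "(x + y)\<^sup>2 \<le> ennreal (1 + d) * x\<^sup>2 + ennreal (1 + 1 / d) * y\<^sup>2"
proof (cases "x = \<infinity> \<or> y = \<infinity>")
  case True
  have "0 < 1 + 1 / d"
    using assms by (simp add: add_pos_pos)
  with True show ?thesis
    using assms by (auto simp: power2_eq_square ennreal_mult_top ennreal_mult_eq_top_iff)
next
  case False
  then obtain a b where ab: "0 \<le> a" "x = ennreal a" "0 \<le> b" "y = ennreal b"
    by (metis ennreal_cases infinity_ennreal_def)
  have "ennreal ((a + b)\<^sup>2) \<le> ennreal ((1 + d) * a\<^sup>2 + (1 + 1 / d) * b\<^sup>2)"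
    by (intro ennreal_leI power2_add_le_weighted assms)
  then show ?thesis
    using ab assms
    by (simp add: ennreal_power ennreal_mult[symmetric] ennreal_plus[symmetric] del: ennreal_plus)
qed

section \<open>Closure properties of locally Lipschitz functions\<close>

lemma locally_lipschitz_imp_continuous_on:
  assumes "locally_lipschitz f"
  shows "continuous_on UNIV f"
proof (rule continuous_at_imp_continuous_on, rule ballI)
  fix x
  obtain U L where U: "open U" "x \<in> U" "L-lipschitz_on U f"
    using assms unfolding locally_lipschitz_def by blast
  then show "continuous (at x) f"
    using lipschitz_on_continuous_on continuous_on_eq_continuous_at by blast
qed

lemma locally_lipschitz_zero: "locally_lipschitz (\<lambda>x. 0)"
  unfolding locally_lipschitz_def
  by (intro allI exI[of _ UNIV] exI[of _ 0]) (auto simp: lipschitz_on_def)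

lemma locally_lipschitz_add:
  assumes "locally_lipschitz f" "locally_lipschitz g"
  shows "locally_lipschitz (\<lambda>x. f x + g x)"
  unfolding locally_lipschitz_def
proof
  fix x
  obtain U L V M where "open U" "x \<in> U" "L-lipschitz_on U f" "open V" "x \<in> V" "M-lipschitz_on V g"
    using assms unfolding locally_lipschitz_def by meson
  moreover from this have "(L + M)-lipschitz_on (U \<inter> V) (\<lambda>x. f x + g x)"
    using lipschitz_on_add[OF lipschitz_on_subset[of L U f "U \<inter> V"] lipschitz_on_subset[of M V g "U \<inter> V"]]
    by simp
  ultimately show "\<exists>U L. open U \<and> x \<in> U \<and> L-lipschitz_on U (\<lambda>x. f x + g x)"
    by (meson IntI open_Int)
qed

lemma locally_lipschitz_cmult:
  assumes "locally_lipschitz f"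
  shows "locally_lipschitz (\<lambda>x. a * f x)"
  unfolding locally_lipschitz_def
proof
  fix x
  obtain U L where "open U" "x \<in> U" "L-lipschitz_on U f"
    using assms unfolding locally_lipschitz_def by meson
  then show "\<exists>U L. open U \<and> x \<in> U \<and> L-lipschitz_on U (\<lambda>x. a * f x)"
    by (intro exI[of _ U] exI[of _ "\<bar>a\<bar> * L"]) (auto intro: lipschitz_on_cmult_real)
qed

lemma locally_lipschitz_contraction:
  assumes "locally_lipschitz g" and T: "\<And>x y. dist (T x) (T y) \<le> dist x y"
  shows "locally_lipschitz (\<lambda>x. g (T x))"
  unfolding locally_lipschitz_def
proof
  fix x
  obtain U L where U: "open U" "T x \<in> U" "L-lipschitz_on U g"
    using assms unfolding locally_lipschitz_def by meson
  have T1: "1-lipschitz_on UNIV T"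
    using T by (auto simp: lipschitz_on_def)
  then have "open (T -` U)"
    using U(1) lipschitz_on_continuous_on open_vimage by blast
  moreover have "(L * 1)-lipschitz_on (T -` U) (\<lambda>x. g (T x))"
    by (rule lipschitz_on_compose2[OF lipschitz_on_subset[OF T1] lipschitz_on_subset[OF U(3)]]) auto
  ultimately show "\<exists>U L. open U \<and> x \<in> U \<and> L-lipschitz_on U (\<lambda>x. g (T x))"
    using U(2) by auto
qed

section \<open>Competitors and the seminorm properties of the energy\<close>

lemma sobolev_energy_le:
  assumes "locally_lipschitz g" "AE x in \<mu>. g x = f x"
  shows "sobolev_energy \<mu> f \<le> (\<integral>\<^sup>+ x. (local_lip_const g x)\<^sup>2 \<partial>\<mu>)"
  unfolding sobolev_energy_def using assms by (intro INF_lower) auto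

lemma sobolev_energy_lessE:
  assumes "sobolev_energy \<mu> f < t"
  obtains g where "locally_lipschitz g" "AE x in \<mu>. g x = f x"
    "(\<integral>\<^sup>+ x. (local_lip_const g x)\<^sup>2 \<partial>\<mu>) < t"
  using assms unfolding sobolev_energy_def INF_less_iff by auto

lemma measurable_local_lip_const:
  assumes "sets \<mu> = sets borel" "locally_lipschitz g"
  shows "local_lip_const g \<in> borel_measurable \<mu>"
  using borel_measurable_local_lip_const[OF locally_lipschitz_imp_continuous_on[OF assms(2)]]
    measurable_cong_sets[OF assms(1) refl] by auto

lemma sobolev_energy_zero [simp]: "sobolev_energy \<mu> (\<lambda>x. 0) = 0"
  using sobolev_energy_le[OF locally_lipschitz_zero, where \<mu>=\<mu> and f="\<lambda>x. 0"] by simp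

lemma sobolev_energy_AE_cong:
  assumes "AE x in \<mu>. f x = g x"
  shows "sobolev_energy \<mu> f = sobolev_energy \<mu> g"
proof -
  have "(AE x in \<mu>. u x = f x) \<longleftrightarrow> (AE x in \<mu>. u x = g x)" for u :: "'a \<Rightarrow> real"
  proof
    assume "AE x in \<mu>. u x = f x"
    with assms show "AE x in \<mu>. u x = g x" by eventually_elim simp
  next
    assume "AE x in \<mu>. u x = g x"
    with assms show "AE x in \<mu>. u x = f x" by eventually_elim simp
  qed
  then show ?thesis
    unfolding sobolev_energy_def by simp
qed

text \<open>The sum of near-optimal competitors for \<open>f\<close> and \<open>g\<close> is a
  competitor for the sum, and the weighted square inequality is applied to the slopes pointwise. The
  family over all \<open>d\<close> carries the triangle inequality for the square root of the
  energy.\<close>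

lemma sobolev_energy_add:
  assumes \<mu>: "sets \<mu> = sets borel" and d: "0 < d"
  shows "sobolev_energy \<mu> (\<lambda>x. f x + g x)
    \<le> ennreal (1 + d) * sobolev_energy \<mu> f + ennreal (1 + 1 / d) * sobolev_energy \<mu> g"
proof (cases "sobolev_energy \<mu> f = \<infinity> \<or> sobolev_energy \<mu> g = \<infinity>")
  case True
  have "0 < 1 + 1 / d"
    using d by (simp add: add_pos_pos)
  with True show ?thesis
    using d by (auto simp: ennreal_mult_top)
next
  case False
  then obtain p q where pq: "0 \<le> p" "sobolev_energy \<mu> f = ennreal p"
      "0 \<le> q" "sobolev_energy \<mu> g = ennreal q"
    by (metis ennreal_cases infinity_ennreal_def)
  define a b where "a = 1 + d" and "b = 1 + 1 / d"
  have ab: "0 < a" "0 < b"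
    using d by (auto simp: a_def b_def add_pos_pos)
  have "sobolev_energy \<mu> (\<lambda>x. f x + g x) \<le> ennreal (a * p + b * q) + ennreal e" if "0 < e" for e
  proof -
    \<comment> \<open>Chosen so that the two losses \<open>a * s\<close> and \<open>b * s\<close>
      together amount to \<open>e\<close>.\<close>
    define s where "s = e / (a + b)"
    have s: "0 < s"
      using that ab by (simp add: s_def)
    have "sobolev_energy \<mu> f < ennreal (p + s)"
      using pq s by (simp add: ennreal_lessI)
    then obtain u where u: "locally_lipschitz u" "AE x in \<mu>. u x = f x"
      "(\<integral>\<^sup>+ x. (local_lip_const u x)\<^sup>2 \<partial>\<mu>) < ennreal (p + s)"
      by (rule sobolev_energy_lessE)
    have "sobolev_energy \<mu> g < ennreal (q + s)"
      using pq s by (simp add: ennreal_lessI)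
    then obtain v where v: "locally_lipschitz v" "AE x in \<mu>. v x = g x"
      "(\<integral>\<^sup>+ x. (local_lip_const v x)\<^sup>2 \<partial>\<mu>) < ennreal (q + s)"
      by (rule sobolev_energy_lessE)
    have [measurable]: "local_lip_const u \<in> borel_measurable \<mu>" "local_lip_const v \<in> borel_measurable \<mu>"
      using u v \<mu> by (auto intro: measurable_local_lip_const)
    have "sobolev_energy \<mu> (\<lambda>x. f x + g x) \<le> (\<integral>\<^sup>+ x. (local_lip_const (\<lambda>x. u x + v x) x)\<^sup>2 \<partial>\<mu>)"
    proof (rule sobolev_energy_le)
      show "locally_lipschitz (\<lambda>x. u x + v x)"
        using u v by (intro locally_lipschitz_add)
      show "AE x in \<mu>. u x + v x = f x + g x"
        using u(2) v(2) by eventually_elim simp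
    qed
    also have "\<dots> \<le> (\<integral>\<^sup>+ x. a * (local_lip_const u x)\<^sup>2 + b * (local_lip_const v x)\<^sup>2 \<partial>\<mu>)"
      unfolding a_def b_def
      by (intro nn_integral_mono order_trans[OF power_mono[OF local_lip_const_add]]
          power2_add_le_weighted_ennreal d) simp
    also have "\<dots> = a * (\<integral>\<^sup>+ x. (local_lip_const u x)\<^sup>2 \<partial>\<mu>) + b * (\<integral>\<^sup>+ x. (local_lip_const v x)\<^sup>2 \<partial>\<mu>)"
      by (simp add: nn_integral_add nn_integral_cmult)
    also have "\<dots> \<le> a * ennreal (p + s) + b * ennreal (q + s)"
      using u(3) v(3) by (intro add_mono mult_left_mono) auto
    also have "\<dots> = ennreal (a * (p + s) + b * (q + s))"
      using ab pq s by (simp add: ennreal_mult[symmetric] ennreal_plus[symmetric] del: ennreal_plus)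
    also have "a * (p + s) + b * (q + s) = (a * p + b * q) + e"
    proof -
      have "(a + b) * s = e"
        using ab by (simp add: s_def)
      then show ?thesis
        by (simp add: algebra_simps)
    qed
    also have "ennreal ((a * p + b * q) + e) = ennreal (a * p + b * q) + ennreal e"
      using ab pq that by (intro ennreal_plus) auto
    finally show ?thesis .
  qed
  then have "sobolev_energy \<mu> (\<lambda>x. f x + g x) \<le> ennreal (a * p + b * q)"
    by (rule ennreal_le_epsilon)
  also have "\<dots> = ennreal a * ennreal p + ennreal b * ennreal q"
    using ab pq by (simp add: ennreal_mult)
  finally show ?thesis
    by (simp add: pq a_def b_def)
qed

text \<open>An estimate for every competitor passes to the infimum because \<open>c\<close> is
  finite and positive, so that it can be divided out in \<open>ennreal\<close>.\<close>

lemma le_cmult_sobolev_energy: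
  assumes c: "0 < c"
    and le: "\<And>u. locally_lipschitz u \<Longrightarrow> AE x in \<mu>. u x = f x \<Longrightarrow>
      t \<le> ennreal c * (\<integral>\<^sup>+ x. (local_lip_const u x)\<^sup>2 \<partial>\<mu>)"
  shows "t \<le> ennreal c * sobolev_energy \<mu> f"
proof -
  have "t / ennreal c \<le> sobolev_energy \<mu> f"
    unfolding sobolev_energy_def using c le
    by (intro INF_greatest divide_le_posI_ennreal) auto
  then have "ennreal c * (t / ennreal c) \<le> ennreal c * sobolev_energy \<mu> f"
    by (rule mult_left_mono) simp
  then show ?thesis
    using c by (simp add: ennreal_times_divide mult_divide_eq_ennreal mult.commute)
qed

lemma sobolev_energy_cmult:
  assumes \<mu>: "sets \<mu> = sets borel"
  shows "sobolev_energy \<mu> (\<lambda>x. a * f x) \<le> ennreal (a\<^sup>2) * sobolev_energy \<mu> f"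
proof (cases "a = 0")
  case False
  then have "0 < a\<^sup>2"
    by simp
  then show ?thesis
  proof (rule le_cmult_sobolev_energy)
    fix u assume u: "locally_lipschitz u" "AE x in \<mu>. u x = f x"
    have [measurable]: "local_lip_const u \<in> borel_measurable \<mu>"
      using u \<mu> by (auto intro: measurable_local_lip_const)
    have "AE x in \<mu>. a * u x = a * f x"
      using u(2) by eventually_elim simp
    then have "sobolev_energy \<mu> (\<lambda>x. a * f x) \<le> (\<integral>\<^sup>+ x. (local_lip_const (\<lambda>x. a * u x) x)\<^sup>2 \<partial>\<mu>)"
      using u by (intro sobolev_energy_le locally_lipschitz_cmult)
    also have "\<dots> \<le> (\<integral>\<^sup>+ x. (ennreal \<bar>a\<bar> * local_lip_const u x)\<^sup>2 \<partial>\<mu>)"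
      by (intro nn_integral_mono power_mono local_lip_const_cmult) simp
    also have "\<dots> = ennreal (a\<^sup>2) * (\<integral>\<^sup>+ x. (local_lip_const u x)\<^sup>2 \<partial>\<mu>)"
      by (simp add: power_mult_distrib nn_integral_cmult ennreal_power)
    finally show "sobolev_energy \<mu> (\<lambda>x. a * f x) \<le> \<dots>" .
  qed
qed simp

section \<open>The energy under a contraction\<close>

lemma scale_measure_eq_density: "scale_measure r M = density M (\<lambda>_. r)"
  by (rule measure_eqI) (auto simp: emeasure_density nn_integral_cmult)

lemma AE_scale_measure_iff:
  assumes "0 < r"
  shows "(AE x in scale_measure r M. P x) \<longleftrightarrow> (AE x in M. P x)"
  unfolding scale_measure_eq_density using assms by (subst AE_density) auto

text \<open>A competitor \<open>u\<close> for \<open>f\<close> gives the competitor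
  \<open>u \<circ> T\<close>, whose slope at \<open>x\<close> is at most that of \<open>u\<close> at
  \<open>T x\<close>; a change of variables then produces the factor \<open>c\<close>.\<close>

lemma sobolev_energy_contraction:
  fixes \<mu>\<^sub>1 :: "'a::metric_space measure" and \<mu>\<^sub>2 :: "'b::metric_space measure"
  assumes \<mu>1: "sets \<mu>\<^sub>1 = sets borel" and \<mu>2: "sets \<mu>\<^sub>2 = sets borel"
    and T: "T \<in> borel_measurable borel" "\<And>x y. dist (T x) (T y) \<le> dist x y"
    and c: "0 < c" and push: "distr \<mu>\<^sub>1 borel T = scale_measure (ennreal c) \<mu>\<^sub>2"
  shows "sobolev_energy \<mu>\<^sub>1 (\<lambda>x. f (T x)) \<le> ennreal c * sobolev_energy \<mu>\<^sub>2 f"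
  using c
proof (rule le_cmult_sobolev_energy)
  fix u assume u: "locally_lipschitz u" "AE x in \<mu>\<^sub>2. u x = f x"
  have [measurable]: "local_lip_const u \<in> borel_measurable borel"
      "local_lip_const u \<in> borel_measurable \<mu>\<^sub>2"
    using u(1) \<mu>2 by (auto intro: measurable_local_lip_const)
  have [measurable]: "T \<in> measurable \<mu>\<^sub>1 borel"
    using T(1) measurable_cong_sets[OF \<mu>1 refl] by auto
  have AE: "AE x in \<mu>\<^sub>1. u (T x) = f (T x)"
  proof (rule AE_distrD[where f = T and P = "\<lambda>y. u y = f y"])
    show "AE x in distr \<mu>\<^sub>1 borel T. u x = f x"
      unfolding push using u(2) c by (subst AE_scale_measure_iff) auto
  qed measurable
  have "sobolev_energy \<mu>\<^sub>1 (\<lambda>x. f (T x)) \<le> (\<integral>\<^sup>+ x. (local_lip_const (\<lambda>x. u (T x)) x)\<^sup>2 \<partial>\<mu>\<^sub>1)"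
    by (rule sobolev_energy_le[OF locally_lipschitz_contraction[OF u(1) T(2)] AE])
  also have "\<dots> \<le> (\<integral>\<^sup>+ x. (local_lip_const u (T x))\<^sup>2 \<partial>\<mu>\<^sub>1)"
    by (intro nn_integral_mono power_mono local_lip_const_contraction T) simp
  also have "\<dots> = (\<integral>\<^sup>+ x. (local_lip_const u x)\<^sup>2 \<partial>distr \<mu>\<^sub>1 borel T)"
    by (subst nn_integral_distr) auto
  also have "\<dots> = ennreal c * (\<integral>\<^sup>+ x. (local_lip_const u x)\<^sup>2 \<partial>\<mu>\<^sub>2)"
    unfolding push by (subst nn_integral_scale_measure) auto
  finally show "sobolev_energy \<mu>\<^sub>1 (\<lambda>x. f (T x)) \<le> \<dots>" .
qed

section \<open>Linear algebra of functions\<close>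

text \<open>Actual functions rather than a.e. classes are added here, and no closure under a.e.
  equality is demanded, in contrast to \<open>L2_subspace\<close>.\<close>

definition function_subspace :: "('a \<Rightarrow> real) set \<Rightarrow> bool" where
  "function_subspace W \<longleftrightarrow>
     (\<lambda>x. 0) \<in> W \<and>
     (\<forall>f\<in>W. \<forall>g\<in>W. (\<lambda>x. f x + g x) \<in> W) \<and>
     (\<forall>a. \<forall>f\<in>W. (\<lambda>x. a * f x) \<in> W)"

text \<open>Linearity is restricted to \<open>W\<close> because the forms used later are integrals,
  and these are additive only where they converge.\<close>

definition linear_form_on :: "('a \<Rightarrow> real) set \<Rightarrow> (('a \<Rightarrow> real) \<Rightarrow> real) \<Rightarrow> bool" where
  "linear_form_on W l \<longleftrightarrow>
     (\<forall>f\<in>W. \<forall>g\<in>W. l (\<lambda>x. f x + g x) = l f + l g) \<and>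
     (\<forall>a. \<forall>f\<in>W. l (\<lambda>x. a * f x) = a * l f)"

text \<open>This is the independence clause of \<open>L2_dim\<close>.\<close>

definition AE_independent :: "'a measure \<Rightarrow> nat \<Rightarrow> (nat \<Rightarrow> 'a \<Rightarrow> real) \<Rightarrow> bool" where
  "AE_independent M n b \<longleftrightarrow>
     (\<forall>a. (AE x in M. (\<Sum>i<n. a i * b i x) = 0) \<longrightarrow> (\<forall>i<n. a i = 0))"

lemma function_subspaceD:
  assumes "function_subspace W"
  shows function_subspace_zero: "(\<lambda>x. 0) \<in> W"
    and function_subspace_add: "f \<in> W \<Longrightarrow> g \<in> W \<Longrightarrow> (\<lambda>x. f x + g x) \<in> W"
    and function_subspace_cmult: "f \<in> W \<Longrightarrow> (\<lambda>x. a * f x) \<in> W"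
  using assms by (auto simp: function_subspace_def)

lemma linear_form_onD:
  assumes "linear_form_on W l"
  shows linear_form_on_add: "f \<in> W \<Longrightarrow> g \<in> W \<Longrightarrow> l (\<lambda>x. f x + g x) = l f + l g"
    and linear_form_on_cmult: "f \<in> W \<Longrightarrow> l (\<lambda>x. a * f x) = a * l f"
  using assms by (auto simp: linear_form_on_def)

lemma function_subspace_lincomb:
  assumes W: "function_subspace W" and w: "\<And>i. i < (n::nat) \<Longrightarrow> w i \<in> W"
  shows "(\<lambda>x. \<Sum>i<n. a i * w i x) \<in> W"
  using w by (induction n) (auto intro!: function_subspaceD[OF W])

lemma linear_form_on_lincomb:
  assumes W: "function_subspace W" and l: "linear_form_on W l"
    and w: "\<And>i. i < (n::nat) \<Longrightarrow> w i \<in> W"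
  shows "l (\<lambda>x. \<Sum>i<n. a i * w i x) = (\<Sum>i<n. a i * l (w i))"
  using w
proof (induction n)
  case 0
  show ?case
    using linear_form_on_cmult[OF l function_subspace_zero[OF W], of 0] by simp
next
  case (Suc n)
  then show ?case
    using function_subspace_lincomb[OF W, of n w a]
    by (simp add: linear_form_on_add[OF l] linear_form_on_cmult[OF l] function_subspace_cmult[OF W])
qed

text \<open>The correctors are dual to the forms \<open>l i\<close> if these are linearly independent; dependent
  forms are allowed, and then some of the correctors can be 0.\<close>

lemma joint_kernel_correctors:
  assumes W: "function_subspace W" and l: "\<And>i. i < (n::nat) \<Longrightarrow> linear_form_on W (l i)"
  shows "\<exists>w. (\<forall>i<n. w i \<in> W) \<and> (\<forall>f\<in>W. \<forall>j<n. l j (\<lambda>x. f x + (\<Sum>i<n. - l i f * w i x)) = 0)"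
  using l
proof (induction n)
  case (Suc n)
  then obtain w where w: "\<forall>i<n. w i \<in> W"
    "\<forall>f\<in>W. \<forall>j<n. l j (\<lambda>x. f x + (\<Sum>i<n. - l i f * w i x)) = 0"
    by fastforce
  \<comment> \<open>\<open>P f\<close> is \<open>f\<close> corrected for the first \<open>n\<close>
    forms: it lies in their joint kernel, and only \<open>l n\<close> remains to be handled.\<close>
  define P where "P f = (\<lambda>x. f x + (\<Sum>i<n. - l i f * w i x))" for f
  have P_in: "P f \<in> W" if "f \<in> W" for f
    unfolding P_def using that w(1)
    by (intro function_subspaceD[OF W] function_subspace_lincomb[OF W]) auto
  have l_P: "l j (P f) = l j f + (\<Sum>i<n. - l i f * l j (w i))" if "f \<in> W" "j < Suc n" for f j
  proof -
    have "l j (P f) = l j f + l j (\<lambda>x. \<Sum>i<n. - l i f * w i x)"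
      unfolding P_def using that w(1) function_subspace_lincomb[OF W, of n w "\<lambda>i. - l i f"]
      by (intro linear_form_on_add[OF Suc.prems]) auto
    also have "l j (\<lambda>x. \<Sum>i<n. - l i f * w i x) = (\<Sum>i<n. - l i f * l j (w i))"
      using w(1) that by (intro linear_form_on_lincomb[OF W Suc.prems]) auto
    finally show ?thesis .
  qed
  have l_P_zero: "l j (P f) = 0" if "f \<in> W" "j < n" for f j
    using that w(2) unfolding P_def by blast
  show ?case
  proof (cases "\<forall>v\<in>W. (\<forall>j<n. l j v = 0) \<longrightarrow> l n v = 0")
    case True
    \<comment> \<open>Here \<open>l n\<close> already vanishes on the joint kernel of its
      predecessors, so the new corrector can be 0.\<close>
    define w' where "w' = w(n := \<lambda>x. 0)"
    have "(\<lambda>x. f x + (\<Sum>i<Suc n. - l i f * w' i x)) = P f" for f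
      by (simp add: w'_def P_def)
    moreover have "\<forall>j<Suc n. l j (P f) = 0" if "f \<in> W" for f
      using that True P_in[of f] l_P_zero[of f] by (metis less_SucE)
    moreover have "\<forall>i<Suc n. w' i \<in> W"
      using w(1) function_subspace_zero[OF W] by (auto simp: w'_def less_Suc_eq)
    ultimately show ?thesis
      by (intro exI[of _ w'] conjI ballI) simp_all
  next
    case False
    then obtain u where u: "u \<in> W" "\<forall>j<n. l j u = 0" "l n u \<noteq> 0"
      by blast
    \<comment> \<open>Normalised so that \<open>l n v = 1\<close>, while the earlier forms vanish at
      \<open>v\<close>.\<close>
    define v where "v = (\<lambda>x. inverse (l n u) * u x)"
    have v: "v \<in> W" "l n v = 1" "\<And>j. j < n \<Longrightarrow> l j v = 0"
      using u function_subspace_cmult[OF W u(1)] linear_form_on_cmult[OF Suc.prems u(1)]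
      unfolding v_def by simp_all
    \<comment> \<open>Subtracting \<open>l n (w i)\<close> times \<open>v\<close> places the old
      correctors in the kernel of \<open>l n\<close> without changing their values under the earlier
      forms.\<close>
    define w' where "w' i = (if i < n then (\<lambda>x. w i x + (- l n (w i)) * v x) else v)" for i
    have w'_in: "w' i \<in> W" if "i < Suc n" for i
    proof (cases "i < n")
      case True
      then have "w i \<in> W"
        using w(1) by blast
      from function_subspace_add[OF W this function_subspace_cmult[OF W v(1), of "- l n (w i)"]]
      show ?thesis
        using True unfolding w'_def by simp
    qed (use v(1) in \<open>simp add: w'_def\<close>)
    have eq: "(\<lambda>x. f x + (\<Sum>i<Suc n. - l i f * w' i x)) = (\<lambda>x. P f x + (- l n (P f)) * v x)"
      if "f \<in> W" for f
    proof
      fix x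
      have "(\<Sum>i<Suc n. - l i f * w' i x)
        = (\<Sum>i<n. - l i f * w i x) + (\<Sum>i<n. l i f * l n (w i)) * v x - l n f * v x"
      proof -
        have "(\<Sum>i<n. - l i f * w' i x) = (\<Sum>i<n. - l i f * w i x + l i f * l n (w i) * v x)"
          by (intro sum.cong) (auto simp: w'_def algebra_simps)
        then show ?thesis
          by (simp add: w'_def sum.distrib sum_subtractf sum_negf sum_distrib_right)
      qed
      also have "\<dots> = (\<Sum>i<n. - l i f * w i x) + (- l n (P f)) * v x"
        using l_P[OF that lessI] by (simp add: sum_negf left_diff_distrib)
      finally show "f x + (\<Sum>i<Suc n. - l i f * w' i x) = P f x + (- l n (P f)) * v x"
        by (simp add: P_def)
    qed
    have "l j (\<lambda>x. P f x + (- l n (P f)) * v x) = 0" if "f \<in> W" "j < Suc n" for f j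
    proof -
      have "l j (\<lambda>x. P f x + (- l n (P f)) * v x) = l j (P f) + (- l n (P f)) * l j v"
        using linear_form_on_add[OF Suc.prems[OF that(2)] P_in[OF that(1)]
            function_subspace_cmult[OF W v(1), of "- l n (P f)"]]
          linear_form_on_cmult[OF Suc.prems[OF that(2)] v(1), of "- l n (P f)"] by simp
      then show ?thesis
        using that v l_P_zero[of f] by (auto simp: less_Suc_eq)
    qed
    then have "\<forall>j<Suc n. l j (\<lambda>x. f x + (\<Sum>i<Suc n. - l i f * w' i x)) = 0" if "f \<in> W" for f
      unfolding eq[OF that] using that by blast
    then show ?thesis
      using w'_in by (intro exI[of _ w'] conjI allI impI ballI) simp_all
  qed
qed auto

section \<open>Linear independence and exchange up to null sets\<close>

lemma homogeneous_system_nontrivial_solution: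
  fixes A :: "'i \<Rightarrow> 'j \<Rightarrow> real"
  assumes "finite J" "finite I" "card J < card I"
  shows "\<exists>a. (\<exists>i\<in>I. a i \<noteq> 0) \<and> (\<forall>j\<in>J. (\<Sum>i\<in>I. a i * A i j) = 0)"
  using assms
proof (induction J arbitrary: I A rule: finite_induct)
  case empty
  then obtain i where "i \<in> I"
    by fastforce
  then show ?case
    by (intro exI[of _ "\<lambda>_. 1"]) auto
next
  case (insert k J)
  show ?case
  proof (cases "\<forall>i\<in>I. A i k = 0")
    case True
    have "card J < card I"
      using insert by simp
    with insert.IH[OF insert.prems(1)] True show ?thesis
      by fastforce
  next
    case False
    then obtain p where p: "p \<in> I" "A p k \<noteq> 0"
      by blast
    \<comment> \<open>Gaussian elimination with pivot \<open>A p k\<close>: equation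
      \<open>k\<close> is used to eliminate the unknown \<open>p\<close> from the equations in
      \<open>J\<close>. Below, \<open>s\<close> is the value of this unknown that equation
      \<open>k\<close> forces.\<close>
    define B where "B i j = A i j - A i k / A p k * A p j" for i j
    have "card J < card (I - {p})"
      using insert p by simp
    then obtain a where a: "\<exists>i\<in>I - {p}. a i \<noteq> 0" "\<forall>j\<in>J. (\<Sum>i\<in>I - {p}. a i * B i j) = 0"
      using insert.IH[of "I - {p}" B] insert.prems by auto
    define s where "s = - (\<Sum>i\<in>I - {p}. a i * A i k) / A p k"
    define a' where "a' = a(p := s)"
    have sum_a': "(\<Sum>i\<in>I. a' i * A i j) = (\<Sum>i\<in>I - {p}. a i * B i j)" for j
    proof -
      have "(\<Sum>i\<in>I. a' i * A i j) = s * A p j + (\<Sum>i\<in>I - {p}. a i * A i j)"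
        using p insert.prems by (simp add: a'_def sum.remove[of I p])
      also have "s * A p j = - (\<Sum>i\<in>I - {p}. a i * (A i k / A p k * A p j))"
        unfolding s_def minus_divide_left[symmetric] mult_minus_left sum_divide_distrib sum_distrib_right
        by (simp add: mult.assoc)
      finally show ?thesis
        by (simp add: B_def right_diff_distrib sum_subtractf)
    qed
    have "(\<Sum>i\<in>I. a' i * A i k) = 0"
      using p by (simp add: sum_a' B_def)
    moreover have "\<exists>i\<in>I. a' i \<noteq> 0"
      using a(1) by (auto simp: a'_def)
    ultimately show ?thesis
      using a(2) by (intro exI[of _ a']) (auto simp: sum_a')
  qed
qed

text \<open>The dimension bound of Steinitz: if all \<open>m\<close> functions were combinations of
  \<open>n < m\<close> others, the coefficient system would have more unknowns than equations, and a
  nontrivial solution would be a vanishing combination of the \<open>b i\<close>.\<close>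

lemma AE_independent_not_spanned:
  assumes b: "AE_independent M m b" and "n < m"
  shows "\<exists>i<m. \<forall>a. \<not> (AE x in M. b i x = (\<Sum>j<n. a j * v j x))"
proof (rule ccontr)
  assume "\<not> ?thesis"
  then have "\<forall>i<m. \<exists>a. AE x in M. b i x = (\<Sum>j<n. a j * v j x)"
    by simp
  then obtain A where A: "\<And>i. i < m \<Longrightarrow> AE x in M. b i x = (\<Sum>j<n. A i j * v j x)"
    by metis
  obtain a where a: "\<exists>i\<in>{..<m}. a i \<noteq> 0" "\<forall>j\<in>{..<n}. (\<Sum>i<m. a i * A i j) = 0"
    using homogeneous_system_nontrivial_solution[of "{..<n}" "{..<m}" A] \<open>n < m\<close> by auto
  have "AE x in M. \<forall>i\<in>{..<m}. b i x = (\<Sum>j<n. A i j * v j x)"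
    using A by (intro AE_finite_allI) auto
  then have "AE x in M. (\<Sum>i<m. a i * b i x) = 0"
  proof eventually_elim
    case (elim x)
    then have "(\<Sum>i<m. a i * b i x) = (\<Sum>i<m. \<Sum>j<n. a i * A i j * v j x)"
      by (simp add: sum_distrib_left mult.assoc)
    also have "\<dots> = (\<Sum>j<n. (\<Sum>i<m. a i * A i j) * v j x)"
      by (subst sum.swap) (simp add: sum_distrib_right)
    also have "\<dots> = 0"
      using a(2) by simp
    finally show ?case .
  qed
  then show False
    using b a(1) unfolding AE_independent_def by auto
qed

lemma AE_independent_extend:
  assumes v: "AE_independent M n v" and u: "\<And>a. \<not> (AE x in M. u x = (\<Sum>j<n. a j * v j x))"
  shows "AE_independent M (Suc n) (v(n := u))"
  unfolding AE_independent_def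
proof (rule allI, rule impI)
  fix a assume "AE x in M. (\<Sum>i<Suc n. a i * (v(n := u)) i x) = 0"
  then have AE: "AE x in M. (\<Sum>i<n. a i * v i x) + a n * u x = 0"
    by simp
  have "a n = 0"
  proof (rule ccontr)
    assume "a n \<noteq> 0"
    have "AE x in M. u x = (\<Sum>j<n. (- a j / a n) * v j x)"
      using AE
    proof eventually_elim
      case (elim x)
      have "(\<Sum>j<n. (- a j / a n) * v j x) = - (\<Sum>j<n. a j * v j x) / a n"
        by (simp add: sum_negf sum_divide_distrib)
      moreover have "u x = - (\<Sum>j<n. a j * v j x) / a n"
        using elim \<open>a n \<noteq> 0\<close> by (simp add: field_simps)
      ultimately show ?case
        by simp
    qed
    then show False
      by (rule notE[OF u])
  qed
  then show "\<forall>i<Suc n. a i = 0"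
    using AE v by (auto simp: AE_independent_def less_Suc_eq)
qed

text \<open>The given \<open>e i\<close> may be dependent, whereas a space of dimension exactly
  \<open>n\<close> is wanted. They are replaced by independent functions spanning at least as much,
  with the gaps filled from the \<open>b i\<close>.\<close>

lemma AE_independent_spanning:
  assumes b: "AE_independent M m b" "\<And>i. i < m \<Longrightarrow> b i \<in> W"
    and e: "\<And>i. i < n \<Longrightarrow> e i \<in> W" and "n \<le> m"
  shows "\<exists>v. (\<forall>i<n. v i \<in> W) \<and> AE_independent M n v \<and>
    (\<forall>i<n. \<exists>a. AE x in M. e i x = (\<Sum>j<n. a j * v j x))"
  using e \<open>n \<le> m\<close>
proof (induction n)
  case 0
  show ?case
    by (auto simp: AE_independent_def)
next
  case (Suc n)
  then obtain v where v: "\<forall>i<n. v i \<in> W" "AE_independent M n v"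
    "\<forall>i<n. \<exists>a. AE x in M. e i x = (\<Sum>j<n. a j * v j x)"
    by fastforce
  \<comment> \<open>The new function \<open>u\<close> is \<open>e n\<close> if that is not yet
    spanned; otherwise it is some \<open>b i\<close> outside the span, which exists because
    \<open>n < m\<close>, and \<open>r = 0\<close>.\<close>
  have "\<exists>u\<in>W. (\<forall>a. \<not> (AE x in M. u x = (\<Sum>j<n. a j * v j x))) \<and>
    (\<exists>a r. AE x in M. e n x = (\<Sum>j<n. a j * v j x) + r * u x)"
  proof (cases "\<exists>a. AE x in M. e n x = (\<Sum>j<n. a j * v j x)")
    case True
    then obtain a where a: "AE x in M. e n x = (\<Sum>j<n. a j * v j x)"
      by blast
    obtain i where "i < m" "\<forall>a. \<not> (AE x in M. b i x = (\<Sum>j<n. a j * v j x))"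
      using AE_independent_not_spanned[OF b(1), of n v] Suc.prems by auto
    then show ?thesis
      using b(2)[of i] a by (intro bexI[of _ "b i"] conjI exI[of _ a] exI[of _ 0]) auto
  next
    case False
    then show ?thesis
      using Suc.prems(1)[of n]
      by (intro bexI[of _ "e n"] conjI exI[of _ "\<lambda>_. 0"] exI[of _ 1]) auto
  qed
  then obtain u a r where u: "u \<in> W" "\<forall>a. \<not> (AE x in M. u x = (\<Sum>j<n. a j * v j x))"
    "AE x in M. e n x = (\<Sum>j<n. a j * v j x) + r * u x"
    by (elim bexE conjE exE)
  have span: "\<exists>a. AE x in M. e i x = (\<Sum>j<Suc n. a j * (v(n := u)) j x)" if "i < Suc n" for i
  proof (cases "i = n")
    case True
    then show ?thesis
      using u(3) by (intro exI[of _ "a(n := r)"]) simp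
  next
    case False
    then have "i < n"
      using that by simp
    then obtain a' where "AE x in M. e i x = (\<Sum>j<n. a' j * v j x)"
      using v(3) by blast
    then show ?thesis
      by (intro exI[of _ "a'(n := 0)"]) simp
  qed
  have "\<forall>i<Suc n. (v(n := u)) i \<in> W"
    using v(1) u(1) by (simp add: less_Suc_eq)
  moreover have "AE_independent M (Suc n) (v(n := u))"
    using u(2) by (intro AE_independent_extend v(2)) auto
  ultimately show ?case
    using span by (intro exI[of _ "v(n := u)"]) blast
qed

section \<open>Approximate orthogonal complements\<close>

text \<open>On a function subspace these are the squares of seminorms: the infimum of the right side
  over \<open>d\<close> is \<open>(sqrt (q f) + sqrt (q g))\<^sup>2\<close>. The form suits both the
  energy and the squared norm and does not presuppose a parallelogram law.\<close>

definition subquadratic_on :: "('a \<Rightarrow> real) set \<Rightarrow> (('a \<Rightarrow> real) \<Rightarrow> real) \<Rightarrow> bool" where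
  "subquadratic_on W q \<longleftrightarrow>
     (\<forall>f\<in>W. 0 \<le> q f) \<and>
     (\<forall>d>0. \<forall>f\<in>W. \<forall>g\<in>W. q (\<lambda>x. f x + g x) \<le> (1 + d) * q f + (1 + 1 / d) * q g) \<and>
     (\<forall>a. \<forall>f\<in>W. q (\<lambda>x. a * f x) \<le> a\<^sup>2 * q f)"

lemma subquadratic_onD:
  assumes "subquadratic_on W q"
  shows subquadratic_on_nonneg: "f \<in> W \<Longrightarrow> 0 \<le> q f"
    and subquadratic_on_add: "0 < d \<Longrightarrow> f \<in> W \<Longrightarrow> g \<in> W \<Longrightarrow>
      q (\<lambda>x. f x + g x) \<le> (1 + d) * q f + (1 + 1 / d) * q g"
    and subquadratic_on_cmult: "f \<in> W \<Longrightarrow> q (\<lambda>x. a * f x) \<le> a\<^sup>2 * q f"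
  using assms by (auto simp: subquadratic_on_def)

text \<open>Small coefficients give a small value of \<open>q\<close> on a finite span: repeated use
  of \<open>d = 1\<close> costs only a constant depending on the \<open>w i\<close>.\<close>

lemma subquadratic_on_lincomb:
  assumes W: "function_subspace W" and q: "subquadratic_on W q"
    and w: "\<And>i. i < (n::nat) \<Longrightarrow> w i \<in> W"
  shows "\<exists>B\<ge>0. \<forall>a. q (\<lambda>x. \<Sum>i<n. a i * w i x) \<le> B * (\<Sum>i<n. (a i)\<^sup>2)"
  using w
proof (induction n)
  case 0
  show ?case
    using subquadratic_on_cmult[OF q function_subspace_zero[OF W], of 0] by auto
next
  case (Suc n)
  then obtain B where B: "0 \<le> B" "\<And>a. q (\<lambda>x. \<Sum>i<n. a i * w i x) \<le> B * (\<Sum>i<n. (a i)\<^sup>2)"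
    by fastforce
  define C where "C = 2 * B + 2 * q (w n)"
  have wn: "w n \<in> W" "0 \<le> q (w n)"
    using Suc.prems subquadratic_on_nonneg[OF q] by auto
  have "q (\<lambda>x. \<Sum>i<Suc n. a i * w i x) \<le> C * (\<Sum>i<Suc n. (a i)\<^sup>2)" for a
  proof -
    have "q (\<lambda>x. (\<Sum>i<n. a i * w i x) + a n * w n x)
      \<le> (1 + 1) * q (\<lambda>x. \<Sum>i<n. a i * w i x) + (1 + 1 / 1) * q (\<lambda>x. a n * w n x)"
      using Suc.prems
      by (intro subquadratic_on_add[OF q] function_subspace_lincomb[OF W] function_subspace_cmult[OF W])
        auto
    also have "\<dots> \<le> 2 * (B * (\<Sum>i<n. (a i)\<^sup>2)) + 2 * ((a n)\<^sup>2 * q (w n))"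
      using B(2)[of a] subquadratic_on_cmult[OF q wn(1), of "a n"] by simp
    also have "\<dots> \<le> C * (\<Sum>i<n. (a i)\<^sup>2) + C * (a n)\<^sup>2"
    proof (rule add_mono)
      show "2 * (B * (\<Sum>i<n. (a i)\<^sup>2)) \<le> C * (\<Sum>i<n. (a i)\<^sup>2)"
        using wn(2) by (simp add: C_def sum_nonneg distrib_right)
      show "2 * ((a n)\<^sup>2 * q (w n)) \<le> C * (a n)\<^sup>2"
        using B(1) by (simp add: C_def distrib_right)
    qed
    finally show ?thesis
      by (simp add: distrib_left)
  qed
  moreover have "0 \<le> C"
    using B(1) wn(2) by (simp add: C_def)
  ultimately show ?case
    by blast
qed

lemma L2_functionsD:
  assumes "f \<in> L2_functions M"
  shows "f \<in> borel_measurable M" "integrable M (\<lambda>x. (f x)\<^sup>2)"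
  using assms by (auto simp: L2_functions_def)

lemma integrable_mult_L2:
  assumes "f \<in> L2_functions M" "g \<in> L2_functions M"
  shows "integrable M (\<lambda>x. f x * g x)"
proof (rule Bochner_Integration.integrable_bound)
  note [measurable] = L2_functionsD(1)[OF assms(1)] L2_functionsD(1)[OF assms(2)]
  show "integrable M (\<lambda>x. (f x)\<^sup>2 + (g x)\<^sup>2)"
    using assms by (intro Bochner_Integration.integrable_add L2_functionsD)
  show "(\<lambda>x. f x * g x) \<in> borel_measurable M"
    by measurable
  have "\<bar>a * b\<bar> \<le> a\<^sup>2 + b\<^sup>2" for a b :: real
    using sum_squares_bound[of "\<bar>a\<bar>" "\<bar>b\<bar>"] mult_nonneg_nonneg[of "\<bar>a\<bar>" "\<bar>b\<bar>"]
    unfolding abs_mult power2_abs by linarith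
  then show "AE x in M. norm (f x * g x) \<le> norm ((f x)\<^sup>2 + (g x)\<^sup>2)"
    by simp
qed

lemma L2_functions_add:
  assumes "f \<in> L2_functions M" "g \<in> L2_functions M"
  shows "(\<lambda>x. f x + g x) \<in> L2_functions M"
  using assms integrable_mult_L2[OF assms] unfolding L2_functions_def
  by (auto simp: power2_sum mult.assoc)

lemma L2_functions_cmult:
  assumes "f \<in> L2_functions M"
  shows "(\<lambda>x. a * f x) \<in> L2_functions M"
  using assms unfolding L2_functions_def by (auto simp: power_mult_distrib)

lemma L2_functions_AE:
  assumes f: "f \<in> L2_functions M" and g: "g \<in> borel_measurable M" "AE x in M. g x = f x"
  shows "g \<in> L2_functions M"
proof -
  note [measurable] = L2_functionsD(1)[OF f] g(1)
  have "AE x in M. (f x)\<^sup>2 = (g x)\<^sup>2"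
    using g(2) by eventually_elim simp
  then have "integrable M (\<lambda>x. (g x)\<^sup>2)"
    by (intro integrable_cong_AE_imp[OF L2_functionsD(2)[OF f]]) auto
  then show ?thesis
    using g(1) by (simp add: L2_functions_def)
qed

lemma subquadratic_on_L2_norm:
  assumes "W \<subseteq> L2_functions M"
  shows "subquadratic_on W (\<lambda>f. \<integral>x. (f x)\<^sup>2 \<partial>M)"
proof -
  have "(\<integral>x. (f x + g x)\<^sup>2 \<partial>M) \<le> (1 + d) * (\<integral>x. (f x)\<^sup>2 \<partial>M) + (1 + 1 / d) * (\<integral>x. (g x)\<^sup>2 \<partial>M)"
    if "0 < d" "f \<in> L2_functions M" "g \<in> L2_functions M" for d f g
  proof -
    have int: "integrable M (\<lambda>x. (1 + d) * (f x)\<^sup>2)" "integrable M (\<lambda>x. (1 + 1 / d) * (g x)\<^sup>2)"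
      using that by (auto intro!: integrable_mult_right L2_functionsD)
    have "(\<integral>x. (f x + g x)\<^sup>2 \<partial>M) \<le> (\<integral>x. (1 + d) * (f x)\<^sup>2 + (1 + 1 / d) * (g x)\<^sup>2 \<partial>M)"
      using that int
      by (intro integral_mono power2_add_le_weighted L2_functionsD(2) L2_functions_add
          Bochner_Integration.integrable_add)
    then show ?thesis
      using int by simp
  qed
  then show ?thesis
    using assms by (auto simp: subquadratic_on_def subset_iff power_mult_distrib)
qed

text \<open>A near minimiser of \<open>f \<mapsto> \<parallel>f\<parallel>\<^sup>2 / 2 - l f\<close> almost represents \<open>l\<close>, so that neither completeness
  of \<open>W\<close> nor density of \<open>W\<close> in \<open>L\<^sup>2\<close> is needed.\<close>

lemma approximate_representation:
  assumes W: "function_subspace W" "W \<subseteq> L2_functions M" and l: "linear_form_on W l"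
    and bdd: "\<And>f. f \<in> W \<Longrightarrow> l f \<le> (\<integral>x. (f x)\<^sup>2 \<partial>M) / 2 + K" and "0 < e"
  shows "\<exists>w\<in>W. \<forall>f\<in>W. (l f - (\<integral>x. f x * w x \<partial>M))\<^sup>2 \<le> e * (\<integral>x. (f x)\<^sup>2 \<partial>M)"
proof -
  define J where "J f = (\<integral>x. (f x)\<^sup>2 \<partial>M) / 2 - l f" for f
  \<comment> \<open>\<open>- K\<close> bounds \<open>J\<close> from below, so a minimiser up to the
    error \<open>e / 2\<close> exists.\<close>
  have bdd_J: "bdd_below (J ` W)"
    using bdd by (intro bdd_belowI[of _ "- K"]) (force simp: J_def)
  have "Inf (J ` W) < Inf (J ` W) + e / 2"
    using \<open>0 < e\<close> by simp
  then obtain w where w: "w \<in> W" "J w < Inf (J ` W) + e / 2"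
    using cInf_lessD[of "J ` W"] function_subspace_zero[OF W(1)] by blast
  have "(l f - (\<integral>x. f x * w x \<partial>M))\<^sup>2 \<le> e * (\<integral>x. (f x)\<^sup>2 \<partial>M)" if f: "f \<in> W" for f
  proof -
    define d where "d = (\<integral>x. f x * w x \<partial>M) - l f"
    define n where "n = (\<integral>x. (f x)\<^sup>2 \<partial>M)"
    have "0 \<le> n"
      by (simp add: n_def)
    \<comment> \<open>The near minimiser \<open>w\<close> is compared with \<open>w + t f\<close>.
      Here \<open>d\<close> is the derivative of \<open>J\<close> at \<open>w\<close> in direction
      \<open>f\<close>, and \<open>n / 2\<close> is the quadratic coefficient.\<close>
    have quad: "- e / 2 < t * d + t\<^sup>2 * n / 2" for t
    proof -
      have tf: "(\<lambda>x. t * f x) \<in> W"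
        using function_subspace_cmult[OF W(1) f] .
      have int: "integrable M (\<lambda>x. (w x)\<^sup>2)" "integrable M (\<lambda>x. (f x)\<^sup>2)"
        "integrable M (\<lambda>x. f x * w x)"
        using f w(1) W(2) by (auto intro!: L2_functionsD integrable_mult_L2)
      have "(\<integral>x. (w x + t * f x)\<^sup>2 \<partial>M)
        = (\<integral>x. (w x)\<^sup>2 + 2 * t * (f x * w x) + t\<^sup>2 * (f x)\<^sup>2 \<partial>M)"
        by (intro Bochner_Integration.integral_cong) (auto simp: power2_eq_square algebra_simps)
      also have "\<dots> = (\<integral>x. (w x)\<^sup>2 \<partial>M) + 2 * t * (\<integral>x. f x * w x \<partial>M) + t\<^sup>2 * n"
        using int by (simp add: n_def)
      finally have "J (\<lambda>x. w x + t * f x) = J w + t * d + t\<^sup>2 * n / 2"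
        using linear_form_on_add[OF l w(1) tf] linear_form_on_cmult[OF l f, of t]
        by (simp add: J_def d_def field_simps)
      moreover have "Inf (J ` W) \<le> J (\<lambda>x. w x + t * f x)"
        using function_subspace_add[OF W(1) w(1) tf] by (intro cInf_lower bdd_J) auto
      ultimately show ?thesis
        using w(2) by simp
    qed
    have "d\<^sup>2 \<le> e * n"
    proof (cases "n = 0")
      case True
      \<comment> \<open>Without a quadratic term a nonzero slope \<open>d\<close> is refuted at
        \<open>t = - e / d\<close>.\<close>
      then show ?thesis
        using quad[of "- e / d"] \<open>0 < e\<close> by (cases "d = 0") auto
    next
      case False
      then have "0 < n"
        using \<open>0 \<le> n\<close> by simp
      \<comment> \<open>\<open>t = - d / n\<close> minimises the quadratic.\<close>
      have "(- d / n) * d + (- d / n)\<^sup>2 * n / 2 = - (d\<^sup>2 / (2 * n))"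
        using \<open>0 < n\<close> by (simp add: power2_eq_square field_simps)
      then have "d\<^sup>2 / (2 * n) < e / 2"
        using quad[of "- d / n"] by simp
      then show ?thesis
        using \<open>0 < n\<close> by (simp add: field_simps)
    qed
    then show ?thesis
      by (simp add: d_def n_def power2_commute)
  qed
  then show ?thesis
    using w(1) by blast
qed

text \<open>A function \<open>f\<close> orthogonal to approximate representers \<open>e i\<close>
  has small \<open>l i f\<close>. Correcting it gives \<open>f'\<close> in the joint kernel, where
  \<open>coercive\<close> applies, and the gap between \<open>s\<close> and \<open>t\<close> pays
  for the change of both \<open>q\<close> and the norm.\<close>

lemma coercive_on_approximate_complement:
  fixes l :: "nat \<Rightarrow> ('a \<Rightarrow> real) \<Rightarrow> real"
  assumes W: "function_subspace W" "W \<subseteq> L2_functions M" and q: "subquadratic_on W q"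
    and l: "\<And>i. i < m \<Longrightarrow> linear_form_on W (l i)"
    and bdd: "\<And>i f. i < m \<Longrightarrow> f \<in> W \<Longrightarrow> l i f \<le> (\<integral>x. (f x)\<^sup>2 \<partial>M) / 2 + K i"
    and coercive: "\<And>f. f \<in> W \<Longrightarrow> (\<And>i. i < m \<Longrightarrow> l i f = 0) \<Longrightarrow> t * (\<integral>x. (f x)\<^sup>2 \<partial>M) \<le> q f"
    and st: "0 \<le> s" "s < t"
  shows "\<exists>e. (\<forall>i<m. e i \<in> W) \<and>
    (\<forall>f\<in>W. (\<forall>i<m. (\<integral>x. f x * e i x \<partial>M) = 0) \<longrightarrow> s * (\<integral>x. (f x)\<^sup>2 \<partial>M) \<le> q f)"
proof -
  define N where "N f = (\<integral>x. (f x)\<^sup>2 \<partial>M)" for f :: "'a \<Rightarrow> real"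
  have N: "subquadratic_on W N"
    using subquadratic_on_L2_norm[OF W(2)] by (simp add: N_def[abs_def])
  obtain w where w: "\<forall>i<m. w i \<in> W"
    "\<forall>f\<in>W. \<forall>j<m. l j (\<lambda>x. f x + (\<Sum>i<m. - l i f * w i x)) = 0"
    using joint_kernel_correctors[OF W(1), of m l] l by blast
  obtain B1 where B1: "0 \<le> B1" "\<And>a. q (\<lambda>x. \<Sum>i<m. a i * w i x) \<le> B1 * (\<Sum>i<m. (a i)\<^sup>2)"
    using subquadratic_on_lincomb[OF W(1) q, of m w] w(1) by blast
  obtain B2 where B2: "0 \<le> B2" "\<And>a. N (\<lambda>x. \<Sum>i<m. a i * w i x) \<le> B2 * (\<Sum>i<m. (a i)\<^sup>2)"
    using subquadratic_on_lincomb[OF W(1) N, of m w] w(1) by blast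
  define B where "B = B1 + B2"
  \<comment> \<open>Because \<open>d * d \<le> d\<close>, the bound
    \<open>d * (3 * s + t + 2) \<le> t - s\<close> yields
    \<open>s * (1 + d)\<^sup>2 \<le> t * (1 - d) - (1 + d) * d\<close>, the inequality needed at the
    end.\<close>
  define d where "d = min 1 ((t - s) / (3 * s + t + 2))"
  have d: "0 < d" "d \<le> 1" "d * (3 * s + t + 2) \<le> t - s"
  proof -
    have "0 < 3 * s + t + 2"
      using st by simp
    moreover have "d \<le> (t - s) / (3 * s + t + 2)"
      by (simp add: d_def)
    ultimately show "d * (3 * s + t + 2) \<le> t - s"
      by (simp add: pos_le_divide_eq)
    show "0 < d" "d \<le> 1"
      using \<open>0 < 3 * s + t + 2\<close> st by (auto simp: d_def)
  qed
  \<comment> \<open>Makes each weighted correction at most \<open>d * N f\<close>; the summand 1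
    keeps the denominator positive when \<open>B * m = 0\<close>.\<close>
  define \<epsilon> where "\<epsilon> = d / ((1 + 1 / d) * (B * m + 1))"
  have pos: "0 < 1 + 1 / d" "0 < B * m + 1"
    using d(1) B1(1) B2(1) by (auto simp: B_def add_pos_pos add_nonneg_pos)
  then have \<epsilon>: "0 < \<epsilon>"
    using d(1) by (simp add: \<epsilon>_def)
  have small: "(1 + 1 / d) * (B * (m * \<epsilon>)) \<le> d"
  proof -
    have "(1 + 1 / d) * (B * (m * \<epsilon>)) \<le> (1 + 1 / d) * ((B * m + 1) * \<epsilon>)"
      using pos \<epsilon> by (intro mult_left_mono) (auto simp: algebra_simps)
    also have "\<dots> = ((1 + 1 / d) * (B * m + 1)) * \<epsilon>"
      by (simp only: mult.assoc)
    also have "\<dots> = d"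
      unfolding \<epsilon>_def using pos by (simp del: times_divide_eq_right add: nonzero_mult_div_cancel_left times_divide_eq_right)
    finally show ?thesis .
  qed
  have "\<exists>e\<in>W. \<forall>f\<in>W. (l i f - (\<integral>x. f x * e x \<partial>M))\<^sup>2 \<le> \<epsilon> * N f" if "i < m" for i
    unfolding N_def by (rule approximate_representation[OF W l[OF that] bdd[OF that] \<epsilon>])
  then obtain e where e: "\<And>i. i < m \<Longrightarrow> e i \<in> W"
    "\<And>i f. i < m \<Longrightarrow> f \<in> W \<Longrightarrow> (l i f - (\<integral>x. f x * e i x \<partial>M))\<^sup>2 \<le> \<epsilon> * N f"
    by metis
  have "s * N f \<le> q f" if f: "f \<in> W" and orth: "\<forall>i<m. (\<integral>x. f x * e i x \<partial>M) = 0" for f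
  proof -
    define g where "g = (\<lambda>x. \<Sum>i<m. - l i f * w i x)"
    \<comment> \<open>\<open>h = - g\<close> recovers \<open>f\<close> from \<open>f'\<close>. Both
      directions are used: \<open>q f'\<close> is bounded through \<open>q f\<close>, but
      \<open>N f\<close> through \<open>N f'\<close>.\<close>
    define h where "h = (\<lambda>x. \<Sum>i<m. l i f * w i x)"
    define f' where "f' = (\<lambda>x. f x + g x)"
    have "g \<in> W" "h \<in> W"
      unfolding g_def h_def using w(1)
      by (intro function_subspace_lincomb[OF W(1)]; blast)+
    then have in_W: "g \<in> W" "h \<in> W" "f' \<in> W"
      unfolding f'_def using f by (auto intro!: function_subspace_add[OF W(1)])
    have f_eq: "f = (\<lambda>x. f' x + h x)"
      by (simp add: f'_def g_def h_def sum_negf)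
    have nonneg: "0 \<le> N f" "0 \<le> q f" "0 \<le> N f'"
      using f in_W subquadratic_on_nonneg[OF q] subquadratic_on_nonneg[OF N] by auto
    have "(\<Sum>i<m. (l i f)\<^sup>2) \<le> (\<Sum>i<m. \<epsilon> * N f)"
      using e(2)[OF _ f] orth by (intro sum_mono) fastforce
    then have sum_le: "(\<Sum>i<m. (l i f)\<^sup>2) \<le> m * \<epsilon> * N f"
      by simp
    \<comment> \<open>\<open>r\<close> stands for \<open>q g\<close> or \<open>N h\<close>, with
      \<open>b\<close> the matching constant \<open>B1\<close> or \<open>B2\<close>.\<close>
    have corr: "(1 + 1 / d) * r \<le> d * N f" if "r \<le> b * (\<Sum>i<m. (l i f)\<^sup>2)" "0 \<le> b" "b \<le> B" for r b
    proof -
      have "r \<le> B * (m * \<epsilon> * N f)"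
        using that(1) mult_mono[OF that(3) sum_le] that(2) B1(1) B2(1)
        by (simp add: sum_nonneg B_def)
      then have "(1 + 1 / d) * r \<le> (1 + 1 / d) * (B * (m * \<epsilon> * N f))"
        using pos by (intro mult_left_mono) auto
      also have "\<dots> = ((1 + 1 / d) * (B * (m * \<epsilon>))) * N f"
        by (simp only: mult.assoc)
      also have "\<dots> \<le> d * N f"
        using small nonneg by (intro mult_right_mono)
      finally show ?thesis .
    qed
    have "(1 + 1 / d) * q g \<le> d * N f"
      using B1(2)[of "\<lambda>i. - l i f"] B1(1) B2(1) unfolding g_def[symmetric]
      by (intro corr[of _ B1]) (auto simp: B_def)
    then have 1: "q f' \<le> (1 + d) * q f + d * N f"
      using subquadratic_on_add[OF q d(1) f in_W(1)] by (simp add: f'_def)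
    have "(1 + 1 / d) * N h \<le> d * N f"
      using B2(2)[of "\<lambda>i. l i f"] B1(1) B2(1) unfolding h_def[symmetric]
      by (intro corr[of _ B2]) (auto simp: B_def)
    then have 2: "N f \<le> (1 + d) * N f' + d * N f"
      using subquadratic_on_add[OF N d(1) in_W(3,2)] by (simp add: f_eq[symmetric])
    have 3: "t * N f' \<le> q f'"
      unfolding N_def using w(2) f in_W(3) by (intro coercive) (auto simp: f'_def g_def)
    have "t * ((1 - d) * N f) \<le> t * ((1 + d) * N f')"
      using 2 st by (intro mult_left_mono) (auto simp: algebra_simps)
    also have "\<dots> = (1 + d) * (t * N f')"
      by simp
    also have "\<dots> \<le> (1 + d) * ((1 + d) * q f + d * N f)"
      using 1 3 d(1) by (intro mult_left_mono) auto
    finally have *: "(t * (1 - d) - (1 + d) * d) * N f \<le> (1 + d)\<^sup>2 * q f"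
      by (simp add: algebra_simps power2_eq_square)
    have "s * (1 + d)\<^sup>2 \<le> t * (1 - d) - (1 + d) * d"
    proof -
      have "d * d \<le> d"
        using d by (simp add: mult_le_cancel_left1)
      then have "s * (d * d) \<le> s * d"
        using st by (intro mult_left_mono)
      with \<open>d * d \<le> d\<close> d(3) show ?thesis
        by (simp add: power2_eq_square algebra_simps)
    qed
    then have "s * (1 + d)\<^sup>2 * N f \<le> (1 + d)\<^sup>2 * q f"
      using * mult_right_mono[OF _ nonneg(1)] by (meson order_trans)
    then have "(1 + d)\<^sup>2 * (s * N f) \<le> (1 + d)\<^sup>2 * q f"
      by (simp add: mult_ac)
    then show ?thesis
      using d(1) by (simp add: mult_le_cancel_left)
  qed
  then show ?thesis
    using e(1) unfolding N_def by blast
qed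

section \<open>Sobolev subspaces and contractions\<close>

lemma function_subspace_L2: "function_subspace (L2_functions M)"
  unfolding function_subspace_def
  by (auto intro: L2_functions_add L2_functions_cmult) (simp add: L2_functions_def)

lemma sobolev_space_subset_L2: "sobolev_space \<mu> \<subseteq> L2_functions \<mu>"
  by (auto simp: sobolev_space_def)

lemma function_subspace_sobolev_space:
  assumes \<mu>: "sets \<mu> = sets borel"
  shows "function_subspace (sobolev_space \<mu>)"
  unfolding function_subspace_def
proof (intro conjI ballI allI)
  show "(\<lambda>x. 0) \<in> sobolev_space \<mu>"
    using function_subspace_zero[OF function_subspace_L2] by (simp add: sobolev_space_def)
next
  fix f g assume fg: "f \<in> sobolev_space \<mu>" "g \<in> sobolev_space \<mu>"
  have "sobolev_energy \<mu> (\<lambda>x. f x + g x)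
    \<le> ennreal (1 + 1) * sobolev_energy \<mu> f + ennreal (1 + 1 / 1) * sobolev_energy \<mu> g"
    by (rule sobolev_energy_add[OF \<mu>]) simp
  also have "\<dots> < \<infinity>"
    using fg by (simp add: sobolev_space_def ennreal_mult_less_top)
  finally show "(\<lambda>x. f x + g x) \<in> sobolev_space \<mu>"
    using fg by (auto simp: sobolev_space_def intro: L2_functions_add)
next
  fix a f assume f: "f \<in> sobolev_space \<mu>"
  have "sobolev_energy \<mu> (\<lambda>x. a * f x) \<le> ennreal (a\<^sup>2) * sobolev_energy \<mu> f"
    by (rule sobolev_energy_cmult[OF \<mu>])
  also have "\<dots> < \<infinity>"
    using f by (simp add: sobolev_space_def ennreal_mult_less_top)
  finally show "(\<lambda>x. a * f x) \<in> sobolev_space \<mu>"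
    using f by (auto simp: sobolev_space_def intro: L2_functions_cmult)
qed

lemma sobolev_space_AE:
  assumes "f \<in> sobolev_space \<mu>" "g \<in> borel_measurable \<mu>" "AE x in \<mu>. g x = f x"
  shows "g \<in> sobolev_space \<mu>"
  using assms L2_functions_AE[of f \<mu> g] sobolev_energy_AE_cong[OF assms(3)]
  by (simp add: sobolev_space_def)

lemma sobolev_energy_eq_ennreal:
  assumes "f \<in> sobolev_space \<mu>"
  shows "sobolev_energy \<mu> f = ennreal (enn2real (sobolev_energy \<mu> f))"
  using assms by (simp add: sobolev_space_def)

lemma subquadratic_on_sobolev_energy:
  assumes \<mu>: "sets \<mu> = sets borel"
  shows "subquadratic_on (sobolev_space \<mu>) (\<lambda>f. enn2real (sobolev_energy \<mu> f))"
  unfolding subquadratic_on_def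
proof (intro conjI ballI allI impI)
  fix d :: real and f g
  assume d: "0 < d" and fg: "f \<in> sobolev_space \<mu>" "g \<in> sobolev_space \<mu>"
  obtain p q where pq: "0 \<le> p" "sobolev_energy \<mu> f = ennreal p"
      "0 \<le> q" "sobolev_energy \<mu> g = ennreal q"
    using sobolev_energy_eq_ennreal[OF fg(1)] sobolev_energy_eq_ennreal[OF fg(2)] enn2real_nonneg
    by metis
  have "sobolev_energy \<mu> (\<lambda>x. f x + g x) \<le> ennreal (1 + d) * ennreal p + ennreal (1 + 1 / d) * ennreal q"
    using sobolev_energy_add[OF \<mu> d, of f g] by (simp only: pq)
  also have "\<dots> = ennreal ((1 + d) * p + (1 + 1 / d) * q)"
    using d pq by (simp add: ennreal_mult[symmetric] ennreal_plus[symmetric] del: ennreal_plus)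
  finally show "enn2real (sobolev_energy \<mu> (\<lambda>x. f x + g x))
      \<le> (1 + d) * enn2real (sobolev_energy \<mu> f) + (1 + 1 / d) * enn2real (sobolev_energy \<mu> g)"
    using d pq by (simp add: enn2real_leI)
next
  fix a f assume f: "f \<in> sobolev_space \<mu>"
  obtain p where p: "0 \<le> p" "sobolev_energy \<mu> f = ennreal p"
    using sobolev_energy_eq_ennreal[OF f] enn2real_nonneg by metis
  have "sobolev_energy \<mu> (\<lambda>x. a * f x) \<le> ennreal (a\<^sup>2 * p)"
    using sobolev_energy_cmult[OF \<mu>, of a f] p by (simp add: ennreal_mult)
  then show "enn2real (sobolev_energy \<mu> (\<lambda>x. a * f x)) \<le> a\<^sup>2 * enn2real (sobolev_energy \<mu> f)"
    using p by (simp add: enn2real_leI)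
qed simp

text \<open>All measurable functions a.e. equal to a combination are included, since subspaces of
  \<open>L\<^sup>2\<close> are represented by sets closed under a.e. equality.\<close>

lemma AE_span_in_sobolev_subspaces:
  assumes \<mu>: "sets \<mu> = sets borel"
    and v: "\<And>i. i < n \<Longrightarrow> v i \<in> sobolev_space \<mu>" "AE_independent \<mu> n v"
  shows "{f \<in> borel_measurable \<mu>. \<exists>a. AE x in \<mu>. f x = (\<Sum>i<n. a i * v i x)} \<in> sobolev_subspaces \<mu> n"
    (is "?E \<in> _")
proof -
  have sub: "?E \<subseteq> sobolev_space \<mu>"
    using function_subspace_lincomb[OF function_subspace_sobolev_space[OF \<mu>], of n v] v(1)
    by (auto intro: sobolev_space_AE)
  have "(\<lambda>x. f x + g x) \<in> ?E" if fg: "f \<in> ?E" "g \<in> ?E" for f g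
  proof -
    obtain a b where ab: "AE x in \<mu>. f x = (\<Sum>i<n. a i * v i x)" "AE x in \<mu>. g x = (\<Sum>i<n. b i * v i x)"
      using fg by auto
    then have "AE x in \<mu>. f x + g x = (\<Sum>i<n. (a i + b i) * v i x)"
      by eventually_elim (simp add: distrib_right sum.distrib)
    then show ?thesis
      using fg by (auto intro: exI[of _ "\<lambda>i. a i + b i"])
  qed
  moreover have "(\<lambda>x. r * f x) \<in> ?E" if f: "f \<in> ?E" for r f
  proof -
    obtain a where a: "AE x in \<mu>. f x = (\<Sum>i<n. a i * v i x)"
      using f by auto
    then have "AE x in \<mu>. r * f x = (\<Sum>i<n. (r * a i) * v i x)"
      by eventually_elim (simp add: sum_distrib_left mult.assoc)
    then show ?thesis
      using f by (auto intro: exI[of _ "\<lambda>i. r * a i"])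
  qed
  moreover have "g \<in> ?E" if f: "f \<in> ?E" and g: "g \<in> borel_measurable \<mu>" "AE x in \<mu>. g x = f x" for f g
  proof -
    obtain a where "AE x in \<mu>. f x = (\<Sum>i<n. a i * v i x)"
      using f by auto
    with g(2) have "AE x in \<mu>. g x = (\<Sum>i<n. a i * v i x)"
      by eventually_elim simp
    then show ?thesis
      using g(1) by auto
  qed
  moreover have "(\<lambda>x. 0) \<in> ?E"
    by (auto intro: exI[of _ "\<lambda>_. 0"])
  ultimately have "L2_subspace \<mu> ?E"
    using sub sobolev_space_subset_L2[of \<mu>] unfolding L2_subspace_def by blast
  moreover have "v i \<in> ?E" if "i < n" for i
  proof -
    have "(\<Sum>j<n. (if j = i then 1 else 0) * v j x) = v i x" for x
      using that by (simp add: if_distrib[of "\<lambda>r. r * _"] cong: if_cong)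
    then show ?thesis
      using v(1)[OF that] sobolev_space_subset_L2[of \<mu>]
      by (auto simp: L2_functions_def intro!: exI[of _ "\<lambda>j. if j = i then 1 else 0"])
  qed
  then have "L2_dim \<mu> ?E n"
    using v(2) unfolding L2_dim_def AE_independent_def by (intro exI[of _ v]) auto
  ultimately show ?thesis
    using sub by (simp add: sobolev_subspaces_def)
qed

lemma sobolev_subspaces_basis:
  assumes "E \<in> sobolev_subspaces \<mu> n"
  shows "\<exists>b. (\<forall>i<n. b i \<in> sobolev_space \<mu>) \<and> AE_independent \<mu> n b \<and>
    (\<forall>f\<in>E. \<exists>a. AE x in \<mu>. f x = (\<Sum>i<n. a i * b i x))"
  using assms unfolding sobolev_subspaces_def L2_dim_def AE_independent_def by blast

section \<open>Pullback along the contraction and comparison of eigenvalues\<close>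

locale metric_measure_contraction =
  fixes \<mu>1 :: "'a::metric_space measure" and \<mu>2 :: "'b::metric_space measure"
    and T :: "'a \<Rightarrow> 'b" and c :: real
  assumes sets1: "sets \<mu>1 = sets borel"
    and sets2: "sets \<mu>2 = sets borel"
    and T: "T \<in> borel_measurable borel"
    and contraction: "dist (T x) (T y) \<le> dist x y"
    and c: "0 < c"
    and push: "distr \<mu>1 borel T = scale_measure (ennreal c) \<mu>2"
begin

lemma T_measurable: "T \<in> measurable \<mu>1 borel"
  using T measurable_cong_sets[OF sets1 refl] by auto

lemma borel_measurable_iff: "h \<in> borel_measurable \<mu>2 \<longleftrightarrow> h \<in> borel_measurable borel"
  by (simp add: measurable_cong_sets[OF sets2 refl])

lemma pullback_measurable:
  assumes "(h :: 'b \<Rightarrow> real) \<in> borel_measurable \<mu>2"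
  shows "(\<lambda>x. h (T x)) \<in> borel_measurable \<mu>1"
  using measurable_compose[OF T_measurable] assms by (simp add: borel_measurable_iff)

lemma pullback_integral:
  fixes h :: "'b \<Rightarrow> real"
  assumes h: "h \<in> borel_measurable \<mu>2"
  shows "integrable \<mu>1 (\<lambda>x. h (T x)) \<longleftrightarrow> integrable \<mu>2 h"
    and "(\<integral>x. h (T x) \<partial>\<mu>1) = c * (\<integral>x. h x \<partial>\<mu>2)"
proof -
  have h': "h \<in> borel_measurable borel"
    using h by (simp add: borel_measurable_iff)
  have "integrable \<mu>1 (\<lambda>x. h (T x)) \<longleftrightarrow> integrable (density \<mu>2 (\<lambda>_. ennreal c)) h"
    by (simp add: integrable_distr_eq[OF T_measurable h', symmetric] push scale_measure_eq_density)
  also have "\<dots> \<longleftrightarrow> integrable \<mu>2 h"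
    using c h by (subst integrable_density) auto
  finally show "integrable \<mu>1 (\<lambda>x. h (T x)) \<longleftrightarrow> integrable \<mu>2 h" .
  have "(\<integral>x. h (T x) \<partial>\<mu>1) = (\<integral>x. h x \<partial>density \<mu>2 (\<lambda>_. ennreal c))"
    by (simp add: integral_distr[OF T_measurable h', symmetric] push scale_measure_eq_density)
  also have "\<dots> = c * (\<integral>x. h x \<partial>\<mu>2)"
    using c h by (subst integral_density) auto
  finally show "(\<integral>x. h (T x) \<partial>\<mu>1) = c * (\<integral>x. h x \<partial>\<mu>2)" .
qed

text \<open>The pullback is thereby well defined and injective on a.e. classes, so independence and
  nonvanishing carry over to \<open>\<mu>1\<close>.\<close>

lemma pullback_AE_zero_iff:
  assumes h: "(h :: 'b \<Rightarrow> real) \<in> borel_measurable \<mu>2"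
  shows "(AE x in \<mu>1. h (T x) = 0) \<longleftrightarrow> (AE x in \<mu>2. h x = 0)"
proof -
  have [measurable]: "h \<in> borel_measurable borel"
    using h by (simp add: borel_measurable_iff)
  have "(AE x in \<mu>1. h (T x) = 0) \<longleftrightarrow> (AE x in distr \<mu>1 borel T. h x = 0)"
    by (rule AE_distr_iff[symmetric, OF T_measurable]) measurable
  also have "\<dots> \<longleftrightarrow> (AE x in \<mu>2. h x = 0)"
    unfolding push using c by (intro AE_scale_measure_iff) simp
  finally show ?thesis .
qed

lemma pullback_L2:
  assumes f: "f \<in> L2_functions \<mu>2"
  shows "(\<lambda>x. f (T x)) \<in> L2_functions \<mu>1"
proof -
  note [measurable] = L2_functionsD(1)[OF f]
  show ?thesis
    using pullback_integral(1)[of "\<lambda>x. (f x)\<^sup>2"] pullback_measurable[of f] L2_functionsD[OF f]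
    by (simp add: L2_functions_def)
qed

lemma pullback_sobolev_energy: "sobolev_energy \<mu>1 (\<lambda>x. f (T x)) \<le> ennreal c * sobolev_energy \<mu>2 f"
  by (rule sobolev_energy_contraction[OF sets1 sets2 T contraction c push])

lemma pullback_sobolev_space:
  assumes f: "f \<in> sobolev_space \<mu>2"
  shows "(\<lambda>x. f (T x)) \<in> sobolev_space \<mu>1"
proof -
  have "ennreal c * sobolev_energy \<mu>2 f < \<infinity>"
    using f by (simp add: sobolev_space_def ennreal_mult_less_top)
  then show ?thesis
    using f pullback_L2[of f] pullback_sobolev_energy[of f]
    by (auto simp: sobolev_space_def intro: le_less_trans)
qed

lemma pullback_AE_independent:
  assumes b: "\<And>i. i < n \<Longrightarrow> b i \<in> borel_measurable \<mu>2" and indep: "AE_independent \<mu>2 n b"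
  shows "AE_independent \<mu>1 n (\<lambda>i x. b i (T x))"
  unfolding AE_independent_def
proof (rule allI, rule impI)
  fix a assume "AE x in \<mu>1. (\<Sum>i<n. a i * b i (T x)) = 0"
  moreover have "(\<lambda>x. \<Sum>i<n. a i * b i x) \<in> borel_measurable \<mu>2"
    using b by (intro borel_measurable_sum borel_measurable_times) auto
  ultimately have "AE x in \<mu>2. (\<Sum>i<n. a i * b i x) = 0"
    using pullback_AE_zero_iff[of "\<lambda>x. \<Sum>i<n. a i * b i x"] by simp
  then show "\<forall>i<n. a i = 0"
    using indep by (simp add: AE_independent_def)
qed

text \<open>These forms meet the hypotheses of \<open>approximate_representation\<close>; the
  quadratic upper bound stands in for boundedness of the form.\<close>

lemma pullback_functional:
  assumes e: "e \<in> L2_functions \<mu>1"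
  shows "linear_form_on (sobolev_space \<mu>2) (\<lambda>f. \<integral>x. f (T x) * e x \<partial>\<mu>1)"
    and "f \<in> sobolev_space \<mu>2 \<Longrightarrow>
      (\<integral>x. f (T x) * e x \<partial>\<mu>1) \<le> (\<integral>x. (f x)\<^sup>2 \<partial>\<mu>2) / 2 + c / 2 * (\<integral>x. (e x)\<^sup>2 \<partial>\<mu>1)"
proof -
  have int: "integrable \<mu>1 (\<lambda>x. f (T x) * e x)" if "f \<in> sobolev_space \<mu>2" for f
    using that sobolev_space_subset_L2[of \<mu>2] by (intro integrable_mult_L2[OF pullback_L2 e]) auto
  then show "linear_form_on (sobolev_space \<mu>2) (\<lambda>f. \<integral>x. f (T x) * e x \<partial>\<mu>1)"
    by (auto simp: linear_form_on_def distrib_right mult.assoc)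
  assume f: "f \<in> sobolev_space \<mu>2"
  then have fT: "integrable \<mu>1 (\<lambda>x. (f (T x))\<^sup>2)"
    using L2_functionsD(2)[OF pullback_L2, of f] sobolev_space_subset_L2[of \<mu>2] by auto
  \<comment> \<open>Young's inequality with weight \<open>c\<close>: the factor
    \<open>1 / (2 * c)\<close> meets the \<open>c\<close> from the change of variables and leaves
    exactly half the squared norm of \<open>f\<close>.\<close>
  have pointwise: "f (T x) * e x \<le> 1 / (2 * c) * (f (T x))\<^sup>2 + c / 2 * (e x)\<^sup>2" for x
  proof -
    have "0 \<le> (f (T x) - c * e x)\<^sup>2 / (2 * c)"
      using c by simp
    also have "\<dots> = 1 / (2 * c) * (f (T x))\<^sup>2 + c / 2 * (e x)\<^sup>2 - f (T x) * e x"
      using c by (simp add: power2_eq_square field_simps)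
    finally show ?thesis
      by simp
  qed
  have "(\<integral>x. f (T x) * e x \<partial>\<mu>1) \<le> (\<integral>x. 1 / (2 * c) * (f (T x))\<^sup>2 + c / 2 * (e x)\<^sup>2 \<partial>\<mu>1)"
    using pointwise fT L2_functionsD(2)[OF e] int[OF f] by (intro integral_mono) auto
  also have "\<dots> = 1 / (2 * c) * (\<integral>x. (f (T x))\<^sup>2 \<partial>\<mu>1) + c / 2 * (\<integral>x. (e x)\<^sup>2 \<partial>\<mu>1)"
    using fT L2_functionsD(2)[OF e] by simp
  also have "(\<integral>x. (f (T x))\<^sup>2 \<partial>\<mu>1) = c * (\<integral>x. (f x)\<^sup>2 \<partial>\<mu>2)"
    using f sobolev_space_subset_L2[of \<mu>2]
    by (intro pullback_integral(2)) (auto dest!: L2_functionsD(1) subsetD)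
  finally show "(\<integral>x. f (T x) * e x \<partial>\<mu>1) \<le> (\<integral>x. (f x)\<^sup>2 \<partial>\<mu>2) / 2 + c / 2 * (\<integral>x. (e x)\<^sup>2 \<partial>\<mu>1)"
    using c by simp
qed

text \<open>Independent functions on the target pull back to independent ones. Hence if the
  eigenvalue of \<open>\<mu>2\<close> is given by its supremum, so is that of \<open>\<mu>1\<close>,
  and the conventional branch \<open>\<infinity>\<close> is not taken there.\<close>

lemma sobolev_subspaces_nonempty:
  assumes "sobolev_subspaces \<mu>2 n \<noteq> {}"
  shows "sobolev_subspaces \<mu>1 n \<noteq> {}"
proof -
  obtain b where b: "\<And>i. i < n \<Longrightarrow> b i \<in> sobolev_space \<mu>2" "AE_independent \<mu>2 n b"
    using assms sobolev_subspaces_basis[of _ \<mu>2 n] by blast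
  have "AE_independent \<mu>1 n (\<lambda>i x. b i (T x))"
    using b sobolev_space_subset_L2[of \<mu>2] by (intro pullback_AE_independent) (auto dest: L2_functionsD)
  with AE_span_in_sobolev_subspaces[OF sets1, of n "\<lambda>i x. b i (T x)"] show ?thesis
    using pullback_sobolev_space b(1) by blast
qed

text \<open>\<open>F\<close> corresponds to \<open>E\<close> only approximately: it contains
  approximate representers of the pairings of pulled-back functions with a basis of
  \<open>E\<close>. This costs the passage from \<open>t\<close> to a smaller
  \<open>s\<close>.\<close>

lemma exists_subspace_rayleigh_ge:
  assumes E: "E \<in> sobolev_subspaces \<mu>1 m" and ne: "sobolev_subspaces \<mu>2 m \<noteq> {}"
    and st: "0 \<le> s" "s < t"
    and t: "\<And>f. f \<in> sobolev_orthogonal_complement \<mu>1 E \<Longrightarrow> \<not> (AE x in \<mu>1. f x = 0) \<Longrightarrow>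
      ennreal t \<le> rayleigh_quotient \<mu>1 f"
  shows "\<exists>F\<in>sobolev_subspaces \<mu>2 m. \<forall>f\<in>sobolev_orthogonal_complement \<mu>2 F.
    \<not> (AE x in \<mu>2. f x = 0) \<longrightarrow> ennreal s \<le> rayleigh_quotient \<mu>2 f"
proof -
  define W where "W = sobolev_space \<mu>2"
  define q where "q f = enn2real (sobolev_energy \<mu>2 f)" for f
  have W: "function_subspace W" "W \<subseteq> L2_functions \<mu>2"
    using function_subspace_sobolev_space[OF sets2] sobolev_space_subset_L2 by (auto simp: W_def)
  have meas: "f \<in> borel_measurable \<mu>2" "integrable \<mu>2 (\<lambda>x. (f x)\<^sup>2)" if "f \<in> W" for f
    using that W(2) L2_functionsD by blast+
  have energy: "sobolev_energy \<mu>2 f = ennreal (q f)" "0 \<le> q f" if "f \<in> W" for f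
    using that sobolev_energy_eq_ennreal[of f \<mu>2] by (auto simp: q_def W_def)
  have norm_pos: "0 < (\<integral>x. (f x)\<^sup>2 \<partial>\<mu>2)" if "f \<in> W" "\<not> (AE x in \<mu>2. f x = 0)" for f
  proof -
    have "(\<integral>x. (f x)\<^sup>2 \<partial>\<mu>2) \<noteq> 0"
      using that integral_nonneg_eq_0_iff_AE[OF meas(2)[OF that(1)]] by simp
    then show ?thesis
      by (simp add: less_le)
  qed
  obtain b where b: "\<And>i. i < m \<Longrightarrow> b i \<in> sobolev_space \<mu>1"
    "\<And>e. e \<in> E \<Longrightarrow> \<exists>a. AE x in \<mu>1. e x = (\<Sum>i<m. a i * b i x)"
    using sobolev_subspaces_basis[OF E] by blast
  have b_L2: "b i \<in> L2_functions \<mu>1" if "i < m" for i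
    using b(1)[OF that] sobolev_space_subset_L2 by blast
  define l where "l i f = (\<integral>x. f (T x) * b i x \<partial>\<mu>1)" for i f
  \<comment> \<open>Vanishing of all \<open>l i f\<close> makes the pullback orthogonal to
    \<open>E\<close>; the factor \<open>c\<close> in the energy bound then cancels the factor
    \<open>c\<close> in the squared norm.\<close>
  have coercive: "t * (\<integral>x. (f x)\<^sup>2 \<partial>\<mu>2) \<le> q f" if f: "f \<in> W" and l0: "\<And>i. i < m \<Longrightarrow> l i f = 0" for f
  proof (cases "AE x in \<mu>2. f x = 0")
    case True
    then have "AE x in \<mu>2. (f x)\<^sup>2 = 0"
      by eventually_elim simp
    then have "(\<integral>x. (f x)\<^sup>2 \<partial>\<mu>2) = 0"
      by (rule integral_eq_zero_AE)
    then show ?thesis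
      using energy(2)[OF f] by simp
  next
    case False
    have fT: "(\<lambda>x. f (T x)) \<in> sobolev_space \<mu>1"
      using f pullback_sobolev_space by (simp add: W_def)
    then have fT_L2: "(\<lambda>x. f (T x)) \<in> L2_functions \<mu>1"
      using sobolev_space_subset_L2 by blast
    have "(\<integral>x. f (T x) * e x \<partial>\<mu>1) = 0" if e: "e \<in> E" for e
    proof -
      have e_L2: "e \<in> L2_functions \<mu>1"
        using E e sobolev_space_subset_L2 by (auto simp: sobolev_subspaces_def)
      note [measurable] = L2_functionsD(1)[OF fT_L2] L2_functionsD(1)[OF e_L2]
      have [measurable]: "b i \<in> borel_measurable \<mu>1" if "i \<in> {..<m}" for i
        using that by (intro L2_functionsD(1) b_L2) auto
      obtain a where a: "AE x in \<mu>1. e x = (\<Sum>i<m. a i * b i x)"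
        using b(2)[OF e] by blast
      have "(\<integral>x. f (T x) * e x \<partial>\<mu>1) = (\<integral>x. (\<Sum>i<m. a i * (f (T x) * b i x)) \<partial>\<mu>1)"
      proof (rule integral_cong_AE)
        show "AE x in \<mu>1. f (T x) * e x = (\<Sum>i<m. a i * (f (T x) * b i x))"
          using a by eventually_elim (simp add: sum_distrib_left mult_ac)
      qed measurable
      also have "\<dots> = (\<Sum>i<m. a i * l i f)"
        using integrable_mult_L2[OF fT_L2 b_L2]
        by (subst Bochner_Integration.integral_sum) (auto simp: l_def)
      finally show ?thesis
        using l0 by simp
    qed
    then have "(\<lambda>x. f (T x)) \<in> sobolev_orthogonal_complement \<mu>1 E"
      using fT by (simp add: sobolev_orthogonal_complement_def)
    moreover have "\<not> (AE x in \<mu>1. f (T x) = 0)"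
      using False pullback_AE_zero_iff[OF meas(1)[OF f]] by simp
    ultimately have "ennreal t \<le> rayleigh_quotient \<mu>1 (\<lambda>x. f (T x))"
      by (rule t)
    also have "\<dots> = sobolev_energy \<mu>1 (\<lambda>x. f (T x)) / ennreal (c * (\<integral>x. (f x)\<^sup>2 \<partial>\<mu>2))"
      using pullback_integral(2)[of "\<lambda>x. (f x)\<^sup>2"] meas[OF f] by (simp add: rayleigh_quotient_def)
    also have "\<dots> \<le> ennreal c * ennreal (q f) / ennreal (c * (\<integral>x. (f x)\<^sup>2 \<partial>\<mu>2))"
      using pullback_sobolev_energy[of f] by (simp add: divide_right_mono_ennreal energy(1)[OF f])
    also have "\<dots> = ennreal (q f / (\<integral>x. (f x)\<^sup>2 \<partial>\<mu>2))"
      using c energy(2)[OF f] norm_pos[OF f False]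
      by (simp add: ennreal_mult[symmetric] divide_ennreal)
    finally have "t \<le> q f / (\<integral>x. (f x)\<^sup>2 \<partial>\<mu>2)"
      using energy(2)[OF f] norm_pos[OF f False] by (subst (asm) ennreal_le_iff) auto
    then show ?thesis
      using norm_pos[OF f False] by (simp add: field_simps)
  qed
  obtain e where e: "\<And>i. i < m \<Longrightarrow> e i \<in> W"
    "\<And>f. f \<in> W \<Longrightarrow> (\<And>i. i < m \<Longrightarrow> (\<integral>x. f x * e i x \<partial>\<mu>2) = 0) \<Longrightarrow> s * (\<integral>x. (f x)\<^sup>2 \<partial>\<mu>2) \<le> q f"
    using coercive_on_approximate_complement[where q = q and l = l and m = m and t = t and s = s
        and K = "\<lambda>i. c / 2 * (\<integral>x. (b i x)\<^sup>2 \<partial>\<mu>1)", OF W _ _ _ coercive st]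
      subquadratic_on_sobolev_energy[OF sets2] pullback_functional[OF b_L2]
    unfolding W_def q_def[abs_def] l_def[abs_def] by blast
  \<comment> \<open>The \<open>e i\<close> may be dependent; \<open>ne\<close> supplies functions
    from which they are filled up to span a space of dimension exactly \<open>m\<close>.\<close>
  obtain b2 where b2: "\<And>i. i < m \<Longrightarrow> b2 i \<in> W" "AE_independent \<mu>2 m b2"
    using ne sobolev_subspaces_basis[of _ \<mu>2 m] unfolding W_def by blast
  obtain v where v: "\<And>i. i < m \<Longrightarrow> v i \<in> W" "AE_independent \<mu>2 m v"
    "\<And>i. i < m \<Longrightarrow> \<exists>a. AE x in \<mu>2. e i x = (\<Sum>j<m. a j * v j x)"
    using AE_independent_spanning[of \<mu>2 m b2 W m e] b2 e(1) by blast
  define F where "F = {f \<in> borel_measurable \<mu>2. \<exists>a. AE x in \<mu>2. f x = (\<Sum>i<m. a i * v i x)}"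
  have "F \<in> sobolev_subspaces \<mu>2 m"
    unfolding F_def using v(1,2) by (intro AE_span_in_sobolev_subspaces sets2) (auto simp: W_def)
  moreover have "ennreal s \<le> rayleigh_quotient \<mu>2 f"
    if f: "f \<in> sobolev_orthogonal_complement \<mu>2 F" and nz: "\<not> (AE x in \<mu>2. f x = 0)" for f
  proof -
    have fW: "f \<in> W" "\<And>g. g \<in> F \<Longrightarrow> (\<integral>x. f x * g x \<partial>\<mu>2) = 0"
      using f by (auto simp: sobolev_orthogonal_complement_def W_def)
    \<comment> \<open>This turns orthogonality to \<open>F\<close> into orthogonality to the
      \<open>e i\<close>, as the bound with \<open>s\<close> requires.\<close>
    have "e i \<in> F" if "i < m" for i
      using v(3)[OF that] meas(1)[OF e(1)[OF that]] by (simp add: F_def)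
    then have "s * (\<integral>x. (f x)\<^sup>2 \<partial>\<mu>2) \<le> q f"
      using fW by (intro e(2)) auto
    then have "s \<le> q f / (\<integral>x. (f x)\<^sup>2 \<partial>\<mu>2)"
      using norm_pos[OF fW(1) nz] by (simp add: field_simps)
    then have "ennreal s \<le> ennreal (q f / (\<integral>x. (f x)\<^sup>2 \<partial>\<mu>2))"
      by (rule ennreal_leI)
    also have "\<dots> = rayleigh_quotient \<mu>2 f"
      using norm_pos[OF fW(1) nz] energy[OF fW(1)] by (simp add: rayleigh_quotient_def divide_ennreal)
    finally show ?thesis .
  qed
  ultimately show ?thesis
    by blast
qed

lemma lip_eigenvalue_le: "lip_eigenvalue \<mu>1 k \<le> lip_eigenvalue \<mu>2 k"
proof (cases "sobolev_subspaces \<mu>2 (k - 1) = {}")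
  case False
  define I1 where "I1 E = (INF f \<in> {f \<in> sobolev_orthogonal_complement \<mu>1 E. \<not> (AE x in \<mu>1. f x = 0)}.
    rayleigh_quotient \<mu>1 f)" for E
  define I2 where "I2 F = (INF f \<in> {f \<in> sobolev_orthogonal_complement \<mu>2 F. \<not> (AE x in \<mu>2. f x = 0)}.
    rayleigh_quotient \<mu>2 f)" for F
  have "I1 E \<le> (SUP F\<in>sobolev_subspaces \<mu>2 (k - 1). I2 F)" if E: "E \<in> sobolev_subspaces \<mu>1 (k - 1)" for E
  proof (rule dense_le)
    fix y assume "y < I1 E"
    \<comment> \<open>The gap between \<open>y\<close> and \<open>z\<close> absorbs the loss from
      \<open>t\<close> to \<open>s\<close>, and both values are finite even if \<open>I1 E\<close>
      is \<open>\<infinity>\<close>.\<close>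
    then obtain z where z: "y < z" "z < I1 E"
      using dense by blast
    then have "y \<noteq> \<infinity>" "z \<noteq> \<infinity>"
      by auto
    then obtain s t where st: "0 \<le> s" "y = ennreal s" "0 \<le> t" "z = ennreal t"
      by (metis ennreal_cases infinity_ennreal_def)
    with z(1) have "s < t"
      by (simp add: ennreal_less_iff)
    have "ennreal t \<le> rayleigh_quotient \<mu>1 f"
      if "f \<in> sobolev_orthogonal_complement \<mu>1 E" "\<not> (AE x in \<mu>1. f x = 0)" for f
    proof -
      have "I1 E \<le> rayleigh_quotient \<mu>1 f"
        unfolding I1_def using that by (intro INF_lower) auto
      then show ?thesis
        using z(2) st by simp
    qed
    from exists_subspace_rayleigh_ge[OF E False st(1) \<open>s < t\<close> this]
    obtain F where F: "F \<in> sobolev_subspaces \<mu>2 (k - 1)"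
      "\<forall>f\<in>sobolev_orthogonal_complement \<mu>2 F. \<not> (AE x in \<mu>2. f x = 0) \<longrightarrow> ennreal s \<le> rayleigh_quotient \<mu>2 f"
      by blast
    have "y \<le> I2 F"
      unfolding I2_def st(2) using F(2) by (intro INF_greatest) auto
    then show "y \<le> (SUP F\<in>sobolev_subspaces \<mu>2 (k - 1). I2 F)"
      by (rule SUP_upper2[OF F(1)])
  qed
  then show ?thesis
    using False sobolev_subspaces_nonempty[OF False]
    by (auto simp: lip_eigenvalue_def I1_def[symmetric] I2_def[symmetric] intro: SUP_least)
\<comment> \<open>Without a subspace of dimension \<open>k - 1\<close> on the target, its eigenvalue
  is \<open>\<infinity>\<close> by definition.\<close>
qed (simp add: lip_eigenvalue_def)

end

theorem proposition3p1:
  fixes \<mu>1 :: "'a::metric_space measure"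
    and \<mu>2 :: "'b::metric_space measure"
    and T :: "'a \<Rightarrow> 'b"
    and c :: real
  assumes "metric_measure_space \<mu>1"
    and "metric_measure_space \<mu>2"
    and "T \<in> borel_measurable borel"
    and "\<And>x y. dist (T x) (T y) \<le> dist x y"
    and "0 < c"
    and "distr \<mu>1 borel T = scale_measure (ennreal c) \<mu>2"
  shows "\<forall>k\<ge>1. lip_eigenvalue \<mu>2 k \<ge> lip_eigenvalue \<mu>1 k"
proof -
  interpret metric_measure_contraction \<mu>1 \<mu>2 T c
    using assms by unfold_locales (auto simp: metric_measure_space_def)
  show ?thesis
    using lip_eigenvalue_le by blast
qed

end
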